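(* Let $\mathcal{P}\subsetneq\mathcal{N}$, $\emptyset\neq\mathcal{Q}\subsetneq\mathcal{N}\setminus\mathcal{P}$, $\mathcal{R}=\mathcal{Q}\cup\mathcal{P}$, and let $\{\mathcal{Q}_j\}_{j\in\mathbb{J}}$ be a partition of $\mathcal{N}\setminus\mathcal{R}$ into nonempty pairwise disjoint sets; put $\mathcal{R}_j=\mathcal{Q}_j\cup\mathcal{P}$. Assume that for each $j\in\mathbb{J}$ every optimal plan $\tau$ of the reduced problem $(\mathrm{RMKP}_{\mathcal{R}_j})$ is concentrated on the graph of a measurable map from $\prod_{k\in\mathcal{P}}X_k$ to $\prod_{k\in\mathcal{Q}_j}X_k$, i.e. $\tau=(\mathrm{id}\times T)\#(\pi_\mathcal{P}\#\tau)$ for some measurable $T$. Let $\lambda$ be an optimal plan of (MKP), $\lambda_\mathcal{R}=\pi_\mathcal{R}\#\lambda$, $\lambda_\mathcal{P}$ and $\lambda_\mathcal{Q}$ its marginals on $\prod_{k\in\mathcal{P}}X_k$ and $\prod_{k\in\mathcal{Q}}X_k$, and let $\lambda_\mathcal{R}=\lambda^{(x_k)_{k\in\mathcal{P}}}_\mathcal{Q}\otimes\lambda_\mathcal{P}$ be the disintegration of $\lambda_\mathcal{R}$ with respect to $\lambda_\mathcal{P}$, with $\lambda^{(x_k)_{k\in\mathcal{P}}}_\mathcal{Q}\in P(\prod_{k\in\mathcal{Q}}X_k)$. Then there are measurable maps $T_{\mathcal{Q}_j}:\prod_{k\in\mathcal{P}}X_k\to\prod_{k\in\mathcal{Q}_j}X_k$,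 $j\in\mathbb{J}$, such that (up to the obvious rearrangement of coordinates) $$\lambda=\Big(\prod_{j\in\mathbb{J}}\delta_{T_{\mathcal{Q}_j}((x_k)_{k\in\mathcal{P}})}\times\lambda_\mathcal{Q}^{(x_k)_{k\in\mathcal{P}}}\Big)\otimes\lambda_\mathcal{P}.$$ Moreover, if $(\mathrm{RMKP}_\mathcal{R})$ and all $(\mathrm{RMKP}_{\mathcal{R}_j})$, $j\in\mathbb{J}$, have unique solutions, then (MKP) has a unique optimal plan.
   Context: Let $N\ge 3$, $\mathcal{N}=\{1,\ldots,N\}$, $\mu_k$ Borel probability measures on complete separable metric spaces $X_k$; $\Pi((\mu_k)_{k\in\mathcal{S}})$ denotes Borel probability measures on $\prod_{k\in\mathcal{S}}X_k$ with marginals $\mu_k$; all index sets are ordered increasingly. The cost $c:\prod_{k\in\mathcal{N}}X_k\to\mathbb{R}$ is lower semicontinuous with $c\ge\sum_ka_k(x_k)$, $a_k\in L_1(\mu_k)$. (MKP) is $\inf\{\int c\,d\lambda:\lambda\in\Pi((\mu_k)_{k\in\mathcal{N}})\}$, assumed attained (minimizers = optimal plans). $(\varphi_k)_{k\in\mathcal{N}}$ is a fixed solution of the dual problem $\sup\{\sum_k\int\varphi_kd\mu_k:\varphi_k\in L_1(\mu_k),\sum_k\varphi_k(x_k)\le c\}$. For $\mathcal{S}\subsetneq\mathcal{N}$, $c_\mathcal{S}((x_k)_{k\in\mathcal{S}})=\inf_{(x_k)_{k\in\mathcal{N}\setminus\mathcal{S}}}\{c((x_k)_{k\in\mathcal{N}})-\sum_{k\in\mathcal{N}\setminus\mathcal{S}}\varphi_k(x_k)\}$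 and $(\mathrm{RMKP}_\mathcal{S})$ is $\inf\{\int c_\mathcal{S}d\tau:\tau\in\Pi((\mu_k)_{k\in\mathcal{S}})\}$. $\pi_\mathcal{S}$ denotes the canonical projection onto $\prod_{k\in\mathcal{S}}X_k$. For a measure $\sigma$ on $A$ and a measurable family $(\eta^a)_{a\in A}$ of probability measures on $B$, $\eta^a\otimes\sigma$ is the measure on $A\times B$ given by $(\eta^a\otimes\sigma)(E\times F)=\int_E\eta^a(F)\,d\sigma(a)$; $\delta_y$ is the Dirac mass at $y$. *)

theory Defs
  imports "HOL-Probability.Probability"
begin

definition borel_of :: "'a topology \<Rightarrow> 'a measure" where
  "borel_of T = sigma (topspace T) {U. openin T U}"

definition lsc_on :: "'a topology \<Rightarrow> ('a \<Rightarrow> real) \<Rightarrow> bool" where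
  "lsc_on T f \<longleftrightarrow> (\<forall>t. openin T {x \<in> topspace T. t < f x})"

(* the integral  \<integral> f d M  of a function bounded below by an integrable one,
   taken as extended real (w.r.t. the completion, so that universally
   measurable functions such as the reduced costs are covered) *)
definition ointegral :: "'b measure \<Rightarrow> ('b \<Rightarrow> real) \<Rightarrow> ereal" where
  "ointegral M f =
     enn2ereal (\<integral>\<^sup>+x. ennreal (f x) \<partial>completion M)
     - enn2ereal (\<integral>\<^sup>+x. ennreal (- f x) \<partial>completion M)"

definition plans :: "(nat \<Rightarrow> 'a measure) \<Rightarrow> nat set \<Rightarrow> (nat \<Rightarrow> 'a) measure set" where
  "plans \<mu> S = {lam. prob_space lam \<and> sets lam = sets (PiM S \<mu>) \<and>
                    (\<forall>k\<in>S. distr lam (\<mu> k) (\<lambda>x. x k) = \<mu> k)}"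

definition optimal_plan ::
  "(nat \<Rightarrow> 'a) measure set \<Rightarrow> ((nat \<Rightarrow> 'a) \<Rightarrow> real) \<Rightarrow> (nat \<Rightarrow> 'a) measure \<Rightarrow> bool" where
  "optimal_plan Pl f lam \<longleftrightarrow> lam \<in> Pl \<and> (\<forall>lam'\<in>Pl. ointegral lam f \<le> ointegral lam' f)"

definition dual_solution ::
  "(nat \<Rightarrow> 'a metric) \<Rightarrow> (nat \<Rightarrow> 'a measure) \<Rightarrow> nat set \<Rightarrow> ((nat \<Rightarrow> 'a) \<Rightarrow> real)
     \<Rightarrow> (nat \<Rightarrow> 'a \<Rightarrow> real) \<Rightarrow> bool" where
  "dual_solution X \<mu> N c \<phi> \<longleftrightarrow>
     (\<forall>k\<in>N. integrable (\<mu> k) (\<phi> k)) \<and>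
     (\<forall>x\<in>PiE N (\<lambda>k. mspace (X k)). (\<Sum>k\<in>N. \<phi> k (x k)) \<le> c x) \<and>
     (\<forall>\<psi>. (\<forall>k\<in>N. integrable (\<mu> k) (\<psi> k)) \<and>
          (\<forall>x\<in>PiE N (\<lambda>k. mspace (X k)). (\<Sum>k\<in>N. \<psi> k (x k)) \<le> c x)
          \<longrightarrow> (\<Sum>k\<in>N. \<integral>y. \<psi> k y \<partial>\<mu> k) \<le> (\<Sum>k\<in>N. \<integral>y. \<phi> k y \<partial>\<mu> k))"

definition red_cost ::
  "(nat \<Rightarrow> 'a metric) \<Rightarrow> nat set \<Rightarrow> ((nat \<Rightarrow> 'a) \<Rightarrow> real) \<Rightarrow> (nat \<Rightarrow> 'a \<Rightarrow> real)
     \<Rightarrow> nat set \<Rightarrow> (nat \<Rightarrow> 'a) \<Rightarrow> real" where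
  "red_cost X N c \<phi> S y =
     Inf {c x - (\<Sum>k\<in>N - S. \<phi> k (x k)) | x. x \<in> PiE N (\<lambda>k. mspace (X k)) \<and> restrict x S = y}"

definition assemble ::
  "nat set \<Rightarrow> nat set \<Rightarrow> 'j set \<Rightarrow> ('j \<Rightarrow> nat set) \<Rightarrow> ('j \<Rightarrow> (nat \<Rightarrow> 'a) \<Rightarrow> (nat \<Rightarrow> 'a))
     \<Rightarrow> (nat \<Rightarrow> 'a) \<Rightarrow> (nat \<Rightarrow> 'a) \<Rightarrow> (nat \<Rightarrow> 'a)" where
  "assemble P Q J Qs T p q =
     (\<lambda>k. if k \<in> P then p k else if k \<in> Q then q k
          else if (\<exists>j\<in>J. k \<in> Qs j) then T (SOME j. j \<in> J \<and> k \<in> Qs j) p k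
          else undefined)"

end

theory Submission
  imports Defs
begin

text \<open>
  By duality, an optimal plan \<open>lam\<close> is concentrated on the set where \<open>c\<close> equals the sum of the
  \<open>\<phi> k\<close>. Since every reduced cost dominates the sum of the remaining \<open>\<phi> k\<close>, with equality on the
  projection of that set, the projections of \<open>lam\<close> are optimal for the reduced problems. Hence the
  coordinates in each \<open>Qs j\<close> are almost surely functions of those in \<open>P\<close>, so \<open>lam\<close> is the image of its
  projection to \<open>R\<close> under a map determined by the projections to the sets \<open>Qs j \<union> P\<close>.

  Duality is obtained as follows. Put \<open>f = c - \<Sum> \<phi> k\<close> and let \<open>p h\<close> be the infimum of the sums of the
  integrals of \<open>\<psi> k\<close> over all \<open>\<psi>\<close> with \<open>h \<le> \<Sum> \<psi> k + t * f\<close> for some \<open>t \<ge> 0\<close>. Optimality of \<open>\<phi>\<close> makes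
  \<open>p\<close> a finite sublinear functional on bounded functions; an additive functional below \<open>p\<close> is a
  finitely additive measure with marginals \<open>\<mu> k\<close>, which by tightness is countably additive, and it
  vanishes on every box on which \<open>f\<close> is bounded away from \<open>0\<close>. The set where \<open>f\<close> is positive is a
  countable union of such boxes, because \<open>c\<close> is lower semicontinuous.
\<close>

section \<open>Dominated additive functionals\<close>

text \<open>The dual problem is only assumed to have a maximiser; that its value is the minimal cost
  has to be proved, and most of the work goes there. The potentials \<open>\<phi> k\<close> are
  merely integrable, so \<open>f\<close> need not be lower semicontinuous, and a Riesz
  representation on continuous functions would not control it. The functional is therefore built on
  all bounded functions, where no countable additivity is available, and it is compared with a
  measure only through its values on boxes. The second obstacle is measurability. A reduced cost is
  an infimum over a possibly uncountable fibre, and the projection of a measurable set need not be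
  measurable. Integrals of reduced costs are therefore only compared with integrals of sums of
  \<open>\<phi> k\<close>, and projections of sets are controlled through compact subsets.
  Uniqueness comes from the form of the reconstruction: maps that rebuild one plan are chosen
  through its projections alone, so they rebuild every optimal plan with the same
  projections.\<close>

lemma minimal_sublinear_functional:
  fixes E :: "('b \<Rightarrow> real) set" and p :: "('b \<Rightarrow> real) \<Rightarrow> real"
  defines "A \<equiv> {q. (\<forall>f. f \<notin> E \<longrightarrow> q f = 0) \<and>
      (\<forall>f\<in>E. \<forall>g\<in>E. q (\<lambda>x. f x + g x) \<le> q f + q g) \<and>
      (\<forall>f\<in>E. \<forall>t>0. q (\<lambda>x. t * f x) \<le> t * q f) \<and> (\<forall>f\<in>E. q f \<le> p f)}"
  assumes scaleE: "\<And>f t. f \<in> E \<Longrightarrow> (\<lambda>x. t * f x) \<in> E"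
    and addE: "\<And>f g. f \<in> E \<Longrightarrow> g \<in> E \<Longrightarrow> (\<lambda>x. f x + g x) \<in> E"
    and p_add: "\<And>f g. f \<in> E \<Longrightarrow> g \<in> E \<Longrightarrow> p (\<lambda>x. f x + g x) \<le> p f + p g"
    and p_scale: "\<And>f t. f \<in> E \<Longrightarrow> 0 < t \<Longrightarrow> p (\<lambda>x. t * f x) \<le> t * p f"
  shows "\<exists>m\<in>A. \<forall>q\<in>A. (\<forall>f. q f \<le> m f) \<longrightarrow> q = m"
proof -
  have A_add: "q (\<lambda>x. f x + g x) \<le> q f + q g" if "q \<in> A" "f \<in> E" "g \<in> E" for q f g
    using that by (simp add: A_def)
  have A_scale: "q (\<lambda>x. t * f x) \<le> t * q f" if "q \<in> A" "f \<in> E" "0 < t" for q f t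
    using that by (simp add: A_def)
  have lower: "- q (\<lambda>x. - f x) \<le> q f" if q: "q \<in> A" and f: "f \<in> E" for q f
  proof -
    have nf: "(\<lambda>x. - f x) \<in> E" using scaleE[OF f, of "-1"] by simp
    have z: "(\<lambda>x. 0) \<in> E" using scaleE[OF f, of 0] by simp
    have "q (\<lambda>x. t * 0) \<le> t * q (\<lambda>x. 0)" if "t > 0" for t :: real
      using A_scale[OF q z that] .
    \<comment> \<open>The factors 1/2 and 2 bound \<open>q\<close> at the zero function from above
      and from below by 0.\<close>
    from this[of "1/2"] this[of 2] have "q (\<lambda>x. 0) = 0" by simp
    moreover have "q (\<lambda>x. f x + - f x) \<le> q f + q (\<lambda>x. - f x)"
      using A_add[OF q f nf] .
    ultimately show ?thesis by simp
  qed
  have qp: "q f \<le> p f" if "q \<in> A" "f \<in> E" for q f using that by (auto simp: A_def)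
  \<comment> \<open>The order is reversed, so a maximal element in Zorn's lemma is a minimal
    functional. The members of \<open>A\<close> are pinned to 0 outside \<open>E\<close>: if left
    free there, their values could be lowered without end.\<close>
  let ?P = "\<lambda>q q' :: ('b \<Rightarrow> real) \<Rightarrow> real. \<forall>f. q' f \<le> q f"
  have "\<exists>m\<in>A. \<forall>a\<in>A. ?P m a \<longrightarrow> a = m"
  proof (rule predicate_Zorn)
    show "partial_order_on A (relation_of ?P A)"
      by (auto simp: partial_order_on_def preorder_on_def relation_of_def refl_on_def trans_def antisym_def
          intro: order_trans intro!: ext order.antisym)
  next
    fix C assume C: "C \<in> Chains (relation_of ?P A)"
    have CA: "C \<subseteq> A" and tot: "\<And>q r. q \<in> C \<Longrightarrow> r \<in> C \<Longrightarrow> ?P q r \<or> ?P r q"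
      using C by (auto simp: Chains_def relation_of_def)
    show "\<exists>u\<in>A. \<forall>a\<in>C. ?P a u"
    proof (cases "C = {}")
      case True
      have "(\<lambda>f. if f \<in> E then p f else 0) \<in> A"
        by (auto simp: A_def p_add p_scale addE scaleE)
      then show ?thesis using True by auto
    next
      case False
      define u where "u f = (if f \<in> E then INF q\<in>C. q f else 0)" for f
      \<comment> \<open>The bound \<open>- p (\<lambda>x. - f x)\<close> is common to the whole
        chain, since \<open>q\<close> vanishes at 0 and is subadditive.\<close>
      have bdd: "bdd_below ((\<lambda>q. q f) ` C)" if "f \<in> E" for f
      proof (rule bdd_belowI2)
        fix q assume "q \<in> C"
        then have "q \<in> A" using CA by auto
        have "(\<lambda>x. - f x) \<in> E" using scaleE[OF that, of "-1"] by simp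
        then have "q (\<lambda>x. - f x) \<le> p (\<lambda>x. - f x)" using qp \<open>q \<in> A\<close> by blast
        then show "- p (\<lambda>x. - f x) \<le> q f" using lower[OF \<open>q \<in> A\<close> that] by linarith
      qed
      have le: "u f \<le> q f" if "q \<in> C" for q f
        using that bdd CA by (cases "f \<in> E") (auto simp: u_def A_def intro: cINF_lower)
      have ge: "b \<le> u f" if "f \<in> E" "\<And>q. q \<in> C \<Longrightarrow> b \<le> q f" for b f
        using that False by (auto simp: u_def intro!: cINF_greatest)
      have "u \<in> A" unfolding A_def
      proof (intro CollectI conjI ballI allI impI)
        fix f g assume fg: "f \<in> E" "g \<in> E"
        have sum: "u (\<lambda>x. f x + g x) \<le> q f + r g" if qr: "q \<in> C" "r \<in> C" for q r
        proof -
          \<comment> \<open>Subadditivity of the infimum involves two members of the chain. The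
            smaller one serves for both, after which the two infima can be taken one at a
            time.\<close>
          obtain s where s: "s \<in> C" "?P q s" "?P r s" using tot[OF qr] qr by auto
          have "u (\<lambda>x. f x + g x) \<le> s (\<lambda>x. f x + g x)" using le s by auto
          also have "\<dots> \<le> s f + s g" using s(1) CA by (intro A_add fg) auto
          also have "\<dots> \<le> q f + r g" using s by (simp add: add_mono)
          finally show ?thesis .
        qed
        have "u (\<lambda>x. f x + g x) - q f \<le> u g" if "q \<in> C" for q
          by (intro ge fg) (use sum[OF that] in \<open>simp add: diff_le_eq add.commute\<close>)
        then have "u (\<lambda>x. f x + g x) - u g \<le> u f"
          by (intro ge fg) (simp add: diff_le_eq add.commute)
        then show "u (\<lambda>x. f x + g x) \<le> u f + u g" by simp
      next
        fix f and t :: real assume f: "f \<in> E" and t: "0 < t"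
        have "u (\<lambda>x. t * f x) / t \<le> q f" if "q \<in> C" for q
        proof -
          have "q (\<lambda>x. t * f x) \<le> t * q f" using CA that by (intro A_scale f t) auto
          then show ?thesis using le[OF that, of "\<lambda>x. t * f x"] t by (simp add: field_simps)
        qed
        then have "u (\<lambda>x. t * f x) / t \<le> u f"
          by (intro ge f)
        then show "u (\<lambda>x. t * f x) \<le> t * u f" using t by (simp add: field_simps)
      next
        fix f assume f: "f \<in> E"
        obtain q where "q \<in> C" using False by auto
        then show "u f \<le> p f" using le[of q f] qp[of q f] f CA by force
      qed (simp add: u_def)
      then show ?thesis using le by auto
    qed
  qed
  then show "\<exists>m\<in>A. \<forall>q\<in>A. (\<forall>f. q f \<le> m f) \<longrightarrow> q = m" .
qed

text \<open>A form of the Hahn-Banach theorem: a functional that is minimal among the sublinear ones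
  below \<open>p\<close> is already additive, because any failure of additivity in a direction
  \<open>y\<close> would allow it to be lowered.\<close>

theorem sublinear_dominates_additive:
  fixes E :: "('b \<Rightarrow> real) set" and p :: "('b \<Rightarrow> real) \<Rightarrow> real"
  assumes scaleE: "\<And>f t. f \<in> E \<Longrightarrow> (\<lambda>x. t * f x) \<in> E"
    and addE: "\<And>f g. f \<in> E \<Longrightarrow> g \<in> E \<Longrightarrow> (\<lambda>x. f x + g x) \<in> E"
    and p_add: "\<And>f g. f \<in> E \<Longrightarrow> g \<in> E \<Longrightarrow> p (\<lambda>x. f x + g x) \<le> p f + p g"
    and p_scale: "\<And>f t. f \<in> E \<Longrightarrow> 0 < t \<Longrightarrow> p (\<lambda>x. t * f x) \<le> t * p f"
  obtains l where "\<And>f g. f \<in> E \<Longrightarrow> g \<in> E \<Longrightarrow> l (\<lambda>x. f x + g x) = l f + l g"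
    and "\<And>f. f \<in> E \<Longrightarrow> l f \<le> p f"
proof -
  define A where "A = {q. (\<forall>f. f \<notin> E \<longrightarrow> q f = 0) \<and>
      (\<forall>f\<in>E. \<forall>g\<in>E. q (\<lambda>x. f x + g x) \<le> q f + q g) \<and>
      (\<forall>f\<in>E. \<forall>t>0. q (\<lambda>x. t * f x) \<le> t * q f) \<and> (\<forall>f\<in>E. q f \<le> p f)}"
  have "\<exists>m\<in>A. \<forall>q\<in>A. (\<forall>f. q f \<le> m f) \<longrightarrow> q = m"
    unfolding A_def by (rule minimal_sublinear_functional; fact)
  then obtain q where q: "q \<in> A" and qmin: "\<And>r. r \<in> A \<Longrightarrow> (\<And>f. r f \<le> q f) \<Longrightarrow> r = q"
    by auto
  have q_add: "q (\<lambda>x. f x + g x) \<le> q f + q g" if "f \<in> E" "g \<in> E" for f g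
    using q that by (simp add: A_def)
  have q_scale: "q (\<lambda>x. t * f x) \<le> t * q f" if "f \<in> E" "0 < t" for f t
    using q that by (simp add: A_def)
  have "q (\<lambda>x. f x + y x) = q f + q y" if f: "f \<in> E" and y: "y \<in> E" for f y
  proof -
    \<comment> \<open>If \<open>q\<close> were linear along \<open>y\<close>, then
      \<open>S x t\<close> would equal \<open>q x\<close> for every \<open>t\<close>. The infimum
      \<open>r\<close> over positive \<open>t\<close> is sublinear and below \<open>q\<close>, so
      minimality gives \<open>r = q\<close>; the value \<open>t = 1\<close> then yields the missing
      inequality of additivity.\<close>
    define S where "S x t = q (\<lambda>u. x u + t * y u) - t * q y" for x and t :: real
    define r where "r x = (if x \<in> E then INF t\<in>{0<..}. S x t else 0)" for x
    have S_le: "S x t \<le> q x" if "x \<in> E" "0 < t" for x t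
      using q_add[OF that(1) scaleE[OF y], of t] q_scale[OF y that(2)] by (simp add: S_def)
    have S_ge: "- q (\<lambda>u. - x u) \<le> S x t" if x: "x \<in> E" and t: "0 < t" for x t
    proof -
      have nx: "(\<lambda>u. - x u) \<in> E" using scaleE[OF x, of "-1"] by simp
      have "q (\<lambda>u. (1/t) * (t * y u)) \<le> (1/t) * q (\<lambda>u. t * y u)"
        using t by (intro q_scale scaleE y) auto
      then have "t * q y \<le> q (\<lambda>u. t * y u)" using t by (simp add: field_simps)
      also have "\<dots> = q (\<lambda>u. (x u + t * y u) + - x u)" by simp
      also have "\<dots> \<le> q (\<lambda>u. x u + t * y u) + q (\<lambda>u. - x u)"
        by (intro q_add addE scaleE x y nx)
      finally show ?thesis by (simp add: S_def)
    qed
    have r_le: "r x \<le> S x t" if "x \<in> E" "0 < t" for x t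
      unfolding r_def using that S_ge by (auto intro!: cINF_lower bdd_belowI2)
    have r_ge: "b \<le> r x" if "x \<in> E" "\<And>t. 0 < t \<Longrightarrow> b \<le> S x t" for x b
      unfolding r_def using that by (auto intro!: cINF_greatest)
    have r_q: "r x \<le> q x" if "x \<in> E" for x
      using r_le[OF that, of 1] S_le[OF that, of 1] by simp
    have "r \<in> A" unfolding A_def
    proof (intro CollectI conjI ballI allI impI)
      fix x z assume xz: "x \<in> E" "z \<in> E"
      have sum: "r (\<lambda>u. x u + z u) \<le> S x t + S z s" if "0 < t" "0 < s" for t s
      proof -
        have "r (\<lambda>u. x u + z u) \<le> S (\<lambda>u. x u + z u) (t + s)"
          by (intro r_le addE xz) (use that in auto)
        also have "\<dots> = q (\<lambda>u. (x u + t * y u) + (z u + s * y u)) - (t + s) * q y"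
          by (simp add: S_def algebra_simps)
        also have "\<dots> \<le> S x t + S z s"
          using q_add[OF addE[OF xz(1) scaleE[OF y]] addE[OF xz(2) scaleE[OF y]], of t s]
          by (simp add: S_def algebra_simps)
        finally show ?thesis .
      qed
      have "r (\<lambda>u. x u + z u) - S x t \<le> r z" if "0 < t" for t
        by (intro r_ge xz) (use sum[OF that] in \<open>simp add: diff_le_eq add.commute\<close>)
      then have "r (\<lambda>u. x u + z u) - r z \<le> r x"
        using xz by (intro r_ge) (auto simp: diff_le_eq add.commute)
      then show "r (\<lambda>u. x u + z u) \<le> r x + r z" by simp
    next
      fix x and t :: real assume x: "x \<in> E" and t: "0 < t"
      have "r (\<lambda>u. t * x u) / t \<le> S x s" if s: "0 < s" for s
      proof -
        have "r (\<lambda>u. t * x u) \<le> S (\<lambda>u. t * x u) (t * s)"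
          by (intro r_le scaleE x) (use s t in auto)
        also have "\<dots> = q (\<lambda>u. t * (x u + s * y u)) - t * s * q y"
          by (simp add: S_def algebra_simps)
        also have "\<dots> \<le> t * S x s"
          using q_scale[OF addE[OF x scaleE[OF y]] t, of s] by (simp add: S_def algebra_simps)
        finally show ?thesis using t by (simp add: field_simps)
      qed
      then have "r (\<lambda>u. t * x u) / t \<le> r x" using x by (intro r_ge)
      then show "r (\<lambda>u. t * x u) \<le> t * r x" using t by (simp add: field_simps)
    next
      fix x assume "x \<in> E"
      moreover have "q x \<le> p x" using q \<open>x \<in> E\<close> by (simp add: A_def)
      ultimately show "r x \<le> p x" using r_q by force
    qed (simp add: r_def)
    moreover have "r x \<le> q x" for x
      using r_q q by (cases "x \<in> E") (auto simp: r_def A_def)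
    ultimately have "r = q" by (rule qmin)
    then have "q f \<le> S f 1" using r_le[OF f, of 1] by simp
    then show ?thesis using q_add[OF f y] by (simp add: S_def)
  qed
  moreover have "q f \<le> p f" if "f \<in> E" for f using q that by (simp add: A_def)
  ultimately show ?thesis using that by blast
qed

section \<open>Inner regularity\<close>

text \<open>The set function is an arbitrary parameter, since the notion serves both for measures
  and for a function that is so far only finitely additive.\<close>

definition inner_approx :: "'b set set \<Rightarrow> ('b set \<Rightarrow> real) \<Rightarrow> 'b set \<Rightarrow> bool" where
  "inner_approx \<K> \<nu> A \<longleftrightarrow> (\<forall>e>0. \<exists>C\<in>\<K>. C \<subseteq> A \<and> \<nu> (A - C) \<le> e)"

lemma inner_approxD:
  assumes "inner_approx \<K> \<nu> A" "e > 0"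
  obtains C where "C \<in> \<K>" "C \<subseteq> A" "\<nu> (A - C) \<le> e"
  using assms unfolding inner_approx_def by blast

lemma sums_geometric_half: "(\<lambda>i. e * (1/2::real) ^ Suc i) sums e"
  using sums_mult[OF power_half_series, of e] by simp

text \<open>Both differences lie in the union of the sets \<open>A i - C i\<close>, whose measures
  are bounded by a geometric series with sum \<open>e\<close>.\<close>

lemma measure_Inter_Union_diff_le:
  fixes A C :: "nat \<Rightarrow> 'b set"
  assumes M: "finite_measure M" and A: "\<And>i. A i \<in> sets M" and C: "\<And>i. C i \<in> sets M"
    and m: "\<And>i. measure M (A i - C i) \<le> e * (1/2) ^ Suc i"
  shows "measure M ((\<Inter>i. A i) - (\<Inter>i. C i)) \<le> e" "measure M ((\<Union>i. A i) - (\<Union>i. C i)) \<le> e"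
proof -
  interpret finite_measure M by fact
  have summ: "summable (\<lambda>i. measure M (A i - C i))"
    by (rule summable_comparison_test'[OF sums_summable[OF sums_geometric_half[of e]], of 0])
      (use m in auto)
  have "measure M (\<Union>i. A i - C i) \<le> (\<Sum>i. measure M (A i - C i))"
    using A C summ by (intro finite_measure_subadditive_countably) auto
  also have "\<dots> \<le> (\<Sum>i. e * (1/2) ^ Suc i)"
    using m summ sums_summable[OF sums_geometric_half[of e]] by (intro suminf_le) auto
  also have "\<dots> = e" using sums_geometric_half by (simp add: sums_iff)
  finally have *: "measure M (\<Union>i. A i - C i) \<le> e" .
  have "measure M ((\<Inter>i. A i) - (\<Inter>i. C i)) \<le> measure M (\<Union>i. A i - C i)"
    using A C by (intro finite_measure_mono) auto
  then show "measure M ((\<Inter>i. A i) - (\<Inter>i. C i)) \<le> e" using * by simp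
  have "measure M ((\<Union>i. A i) - (\<Union>i. C i)) \<le> measure M (\<Union>i. A i - C i)"
    using A C by (intro finite_measure_mono) auto
  then show "measure M ((\<Union>i. A i) - (\<Union>i. C i)) \<le> e" using * by simp
qed

text \<open>The approximating classes are closed under finite unions only, so a countable union has
  to be truncated at a small loss. This is continuity from above along the remainders.\<close>

lemma exhaust_by_finite_union:
  fixes C :: "nat \<Rightarrow> 'b set"
  assumes M: "finite_measure M" and C: "\<And>i. C i \<in> sets M" and e: "e > 0"
  obtains n where "measure M ((\<Union>i. C i) - (\<Union>i<n. C i)) \<le> e"
proof -
  interpret finite_measure M by fact
  have "(\<lambda>n. measure M ((\<Union>i. C i) - (\<Union>i<n. C i))) \<longlonglongrightarrow> measure M (\<Inter>n. (\<Union>i. C i) - (\<Union>i<n. C i))"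
  proof (rule finite_Lim_measure_decseq)
    show "range (\<lambda>n. (\<Union>i. C i) - (\<Union>i<n. C i)) \<subseteq> sets M"
      using C by auto
    show "decseq (\<lambda>n. (\<Union>i. C i) - (\<Union>i<n. C i))"
      by (fastforce simp: decseq_def)
  qed
  moreover have "(\<Inter>n. (\<Union>i. C i) - (\<Union>i<n. C i)) = {}" by fastforce
  ultimately have "(\<lambda>n. measure M ((\<Union>i. C i) - (\<Union>i<n. C i))) \<longlonglongrightarrow> 0"
    by (simp only: measure_empty)
  then have "\<forall>\<^sub>F n in sequentially. measure M ((\<Union>i. C i) - (\<Union>i<n. C i)) < e"
    using e by (rule order_tendstoD)
  then show ?thesis using that by (meson eventually_sequentially less_imp_le order_refl)
qed

text \<open>The sets that are approximable together with their complements form a sigma-algebra.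
  Carrying the complement along makes the complement case of the induction trivial; in exchange the
  union case also has to treat a countable intersection, which is where \<open>K_Inter\<close>
  enters.\<close>

lemma inner_approx_sigma_sets:
  assumes M: "finite_measure M" and gen: "sets M = sigma_sets (space M) G"
    and K_sets: "\<And>C. C \<in> \<K> \<Longrightarrow> C \<in> sets M"
    and K_Un: "\<And>C D. C \<in> \<K> \<Longrightarrow> D \<in> \<K> \<Longrightarrow> C \<union> D \<in> \<K>" and K_empty: "{} \<in> \<K>"
    and K_Inter: "\<And>C :: nat \<Rightarrow> _. (\<And>i. C i \<in> \<K>) \<Longrightarrow> (\<Inter>i. C i) \<in> \<K>"
    and top: "inner_approx \<K> (measure M) (space M)"
    and G: "\<And>B. B \<in> G \<Longrightarrow> inner_approx \<K> (measure M) B"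
           "\<And>B. B \<in> G \<Longrightarrow> inner_approx \<K> (measure M) (space M - B)"
    and A: "A \<in> sets M"
  shows "inner_approx \<K> (measure M) A"
proof -
  interpret finite_measure M by fact
  have "A \<in> sigma_sets (space M) G" using A gen by simp
  then have "inner_approx \<K> (measure M) A \<and> inner_approx \<K> (measure M) (space M - A)"
  proof induction
    case (Basic a)
    then show ?case using G by auto
  next
    case Empty
    then show ?case using top K_empty by (auto simp: inner_approx_def)
  next
    case (Compl a)
    then have "a \<subseteq> space M" using gen sets.sets_into_space by blast
    then have "space M - (space M - a) = a" by auto
    then show ?case using Compl by auto
  next
    case (Union a)
    have a: "a i \<in> sets M" for i using Union(1) gen by simp
    show ?case
    proof
      show "inner_approx \<K> (measure M) (\<Union> (range a))" unfolding inner_approx_def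
      proof (intro allI impI)
        fix e :: real assume e: "e > 0"
        \<comment> \<open>One half of \<open>e\<close> pays for approximating the sets
          \<open>a i\<close>, the other half for truncating the union.\<close>
        have "\<exists>C\<in>\<K>. C \<subseteq> a i \<and> measure M (a i - C) \<le> e/2 * (1/2) ^ Suc i" for i
          by (rule inner_approxD[OF conjunct1[OF Union(2)[of i]], of "e/2 * (1/2) ^ Suc i"]) (use e in auto)
        then obtain C where C: "\<And>i. C i \<in> \<K>" "\<And>i. C i \<subseteq> a i"
          "\<And>i. measure M (a i - C i) \<le> e/2 * (1/2) ^ Suc i" by metis
        have Cs: "C i \<in> sets M" for i using C K_sets by auto
        obtain n where n: "measure M ((\<Union>i. C i) - (\<Union>i<n. C i)) \<le> e/2"
          using exhaust_by_finite_union[where C = C and e = "e/2", OF M Cs] e by auto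
        have "measure M ((\<Union>i. a i) - (\<Union>i<n. C i)) \<le>
            measure M (((\<Union>i. a i) - (\<Union>i. C i)) \<union> ((\<Union>i. C i) - (\<Union>i<n. C i)))"
          using a Cs by (intro finite_measure_mono) auto
        also have "\<dots> \<le> measure M ((\<Union>i. a i) - (\<Union>i. C i)) + measure M ((\<Union>i. C i) - (\<Union>i<n. C i))"
          using a Cs by (intro measure_Un_le) auto
        also have "\<dots> \<le> e" using n measure_Inter_Union_diff_le(2)[OF M a Cs C(3)] by simp
        finally have "measure M ((\<Union>i. a i) - (\<Union>i<n. C i)) \<le> e" .
        moreover have "(\<Union>i<n. C i) \<in> \<K>"
          by (induction n) (auto simp: lessThan_Suc K_empty intro!: K_Un C)
        moreover have "(\<Union>i<n. C i) \<subseteq> (\<Union>i. a i)" using C(2) by blast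
        ultimately show "\<exists>C\<in>\<K>. C \<subseteq> \<Union> (range a) \<and> measure M (\<Union> (range a) - C) \<le> e" by blast
      qed
      show "inner_approx \<K> (measure M) (space M - \<Union> (range a))" unfolding inner_approx_def
      proof (intro allI impI)
        fix e :: real assume e: "e > 0"
        have "\<exists>C\<in>\<K>. C \<subseteq> space M - a i \<and> measure M ((space M - a i) - C) \<le> e * (1/2) ^ Suc i" for i
          by (rule inner_approxD[OF conjunct2[OF Union(2)[of i]], of "e * (1/2) ^ Suc i"]) (use e in auto)
        then obtain C where C: "\<And>i. C i \<in> \<K>" "\<And>i. C i \<subseteq> space M - a i"
          "\<And>i. measure M ((space M - a i) - C i) \<le> e * (1/2) ^ Suc i" by metis
        have "measure M ((\<Inter>i. space M - a i) - (\<Inter>i. C i)) \<le> e"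
          using a K_sets[OF C(1)] by (intro measure_Inter_Union_diff_le(1)[OF M _ _ C(3)]) auto
        moreover have "(\<Inter>i. space M - a i) = space M - \<Union> (range a)" by auto
        moreover have "(\<Inter>i. C i) \<subseteq> space M - \<Union> (range a)" using C(2) by blast
        ultimately show "\<exists>C\<in>\<K>. C \<subseteq> space M - \<Union> (range a) \<and> measure M (space M - \<Union> (range a) - C) \<le> e"
          using K_Inter[of C, OF C(1)] by auto
      qed
    qed
  qed
  then show ?thesis by simp
qed

section \<open>Tightness of Borel measures on complete separable metric spaces\<close>

lemma sets_borel_of: "sets (borel_of T) = sigma_sets (topspace T) {U. openin T U}"
  and space_borel_of: "space (borel_of T) = topspace T"
proof -
  have "{U. openin T U} \<subseteq> Pow (topspace T)" by (auto dest: openin_subset)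
  then show "sets (borel_of T) = sigma_sets (topspace T) {U. openin T U}"
    and "space (borel_of T) = topspace T"
    unfolding borel_of_def by (rule sets_measure_of, rule space_measure_of)
qed

lemma Hausdorff_space_mtopology_of: "Hausdorff_space (mtopology_of X)"
  by (simp add: mtopology_of_def Metric_space.Hausdorff_space_mtopology)

lemma second_countable_mtopology_of:
  assumes "separable_space (mtopology_of X)"
  shows "second_countable (mtopology_of X)"
proof -
  interpret Metric_space "mspace X" "mdist X" by simp
  obtain D where D: "countable D" "D \<subseteq> mspace X" "mtopology closure_of D = mspace X"
    using assms unfolding separable_space_def mtopology_of_def by auto
  let ?B = "(\<lambda>(x, r). mball x r) ` (D \<times> (\<rat> :: real set))"
  have "\<exists>V\<in>?B. x \<in> V \<and> V \<subseteq> U" if U: "openin mtopology U" and x: "x \<in> U" for U x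
  proof -
    obtain r where r: "r > 0" "mball x r \<subseteq> U" and xM: "x \<in> mspace X" using U x
      by (meson openin_mtopology subsetD)
    \<comment> \<open>The lower bound keeps \<open>q\<close> positive, so that the ball around
      \<open>x\<close> meets \<open>D\<close>; the upper bound makes \<open>2 * q < r\<close>, so
      that a ball of radius \<open>q\<close> around a point within \<open>q\<close> of
      \<open>x\<close> stays in \<open>mball x r\<close>.\<close>
    obtain q where q: "q \<in> \<rat>" "r/4 < q" "q < r/2"
      using Rats_dense_in_real[of "r/4" "r/2"] r by auto
    have "mball x q \<noteq> {}" using centre_in_mball_iff[of x q] xM q r by force
    then have "D \<inter> mball x q \<noteq> {}"
      using D(3) dense_intersects_open[of mtopology D] openin_mball by simp
    then obtain y where y: "y \<in> D" "y \<in> mball x q" by blast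
    have "x \<in> mball y q" using y by (simp add: commute)
    moreover have "mball y q \<subseteq> mball x r"
    proof (rule mball_subset)
      show "mdist X y x + q \<le> r" using y(2) q by (simp add: commute)
    qed (use xM in simp)
    ultimately show ?thesis using r(2) y(1) q(1) by blast
  qed
  moreover have "countable ?B" using D(1) countable_rat by blast
  ultimately show ?thesis
    unfolding second_countable_def mtopology_of_def by (intro exI[of _ ?B]) auto
qed

text \<open>Ulam's argument: for each \<open>n\<close>, finitely many balls of radius
  \<open>1 / (n + 1)\<close> cover the space up to a geometrically small error. The intersection
  over \<open>n\<close> of these finite unions is closed and totally bounded, hence compact by
  completeness.\<close>

lemma inner_approx_compact_space:
  assumes complete: "mcomplete_of X" and sep: "separable_space (mtopology_of X)"
    and M: "finite_measure M" and sets: "sets M = sets (borel_of (mtopology_of X))"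
  shows "inner_approx {K. compactin (mtopology_of X) K} (measure M) (space M)"
proof (cases "mspace X = {}")
  case True
  then have "space M = {}" using sets_eq_imp_space_eq[OF sets] by (simp add: space_borel_of)
  then show ?thesis by (auto simp: inner_approx_def intro!: exI[of _ "{}"])
next
  case False
  interpret finite_measure M by fact
  interpret Metric_space "mspace X" "mdist X" by simp
  have spM: "space M = mspace X" using sets_eq_imp_space_eq[OF sets] by (simp add: space_borel_of)
  have closed_sets: "C \<in> sets M" if "closedin mtopology C" for C
  proof -
    have "mspace X - C \<in> sets M"
      using that unfolding sets sets_borel_of mtopology_of_def
      by (auto simp: closedin_def)
    then have "space M - (mspace X - C) \<in> sets M" by (rule sets.compl_sets)
    moreover have "space M - (mspace X - C) = C" using closedin_subset[OF that] spM by auto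
    ultimately show ?thesis by simp
  qed
  obtain D where D: "countable D" "D \<subseteq> mspace X" "mtopology closure_of D = mspace X"
    using sep unfolding separable_space_def mtopology_of_def by auto
  have Dne: "D \<noteq> {}" using D(3) False by auto
  define d where "d = from_nat_into D"
  have d: "d i \<in> mspace X" for i using D(2) from_nat_into[OF Dne] by (auto simp: d_def)
  define B where "B n i = mcball (d i) (inverse (real (Suc n)))" for n i
  have B_sets: "B n i \<in> sets M" for n i unfolding B_def by (intro closed_sets closedin_mcball)
  have cover: "(\<Union>i. B n i) = space M" for n
  proof
    show "space M \<subseteq> (\<Union>i. B n i)"
    proof
      fix x assume "x \<in> space M"
      then have x: "x \<in> mspace X" using spM by simp
      then have "mball x (inverse (real (Suc n))) \<noteq> {}"
        using centre_in_mball_iff[of x "inverse (real (Suc n))"] by force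
      then have "D \<inter> mball x (inverse (real (Suc n))) \<noteq> {}"
        using D(3) dense_intersects_open[of mtopology D] openin_mball by simp
      then obtain y where y: "y \<in> D" "y \<in> mball x (inverse (real (Suc n)))" by blast
      then obtain i where "y = d i" using from_nat_into_surj[OF D(1)] unfolding d_def by metis
      then have "x \<in> B n i" using y(2) by (simp add: B_def commute less_imp_le)
      then show "x \<in> (\<Union>i. B n i)" by blast
    qed
  qed (use sets.sets_into_space[OF B_sets] in blast)
  show ?thesis unfolding inner_approx_def
  proof (intro allI impI)
    fix e :: real assume e: "e > 0"
    have "\<exists>m. measure M (space M - (\<Union>i<m. B n i)) \<le> e * (1/2) ^ Suc n" for n
      using exhaust_by_finite_union[where C = "B n" and e = "e * (1/2) ^ Suc n", OF M B_sets] e cover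
      by (metis mult_pos_pos zero_less_power half_gt_zero zero_less_one)
    then obtain m where m: "\<And>n. measure M (space M - (\<Union>i<m n. B n i)) \<le> e * (1/2) ^ Suc n"
      by metis
    define K where "K = (\<Inter>n. \<Union>i<m n. B n i)"
    have clK: "closedin mtopology K"
      unfolding K_def B_def by (intro closedin_INT closedin_Union) auto
    have KM: "K \<subseteq> mspace X" using closedin_subset[OF clK] by simp
    have "mtotally_bounded K" unfolding mtotally_bounded_def
    proof (intro allI impI)
      fix r :: real assume "r > 0"
      then obtain n where n: "inverse (real (Suc n)) < r/2"
        using reals_Archimedean[of "r/2"] by auto
      \<comment> \<open>The centres \<open>d i\<close> may lie outside \<open>K\<close>, whereas
        total boundedness asks for centres in \<open>K\<close>. Replacing \<open>d i\<close> by a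
        point \<open>s i\<close> of \<open>K\<close> in the same ball doubles the radius, which
        explains the choice of \<open>n\<close> through \<open>r/2\<close>.\<close>
      define I where "I = {i. i < m n \<and> K \<inter> B n i \<noteq> {}}"
      define s where "s i = (SOME x. x \<in> K \<inter> B n i)" for i
      have s: "s i \<in> K \<inter> B n i" if "i \<in> I" for i
        unfolding s_def by (rule someI_ex) (use that I_def in blast)
      have "K \<subseteq> (\<Union>x\<in>s ` I. mball x r)"
      proof
        fix x assume x: "x \<in> K"
        then obtain i where i: "i < m n" "x \<in> B n i" unfolding K_def by auto
        then have iI: "i \<in> I" using x by (auto simp: I_def)
        have "mdist X (s i) x \<le> mdist X (s i) (d i) + mdist X (d i) x"
          using s[OF iI] x KM d by (intro triangle) auto
        also have "\<dots> < r" using s[OF iI] i(2) n by (simp add: B_def commute)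
        finally have "x \<in> mball (s i) r" using s[OF iI] x KM by auto
        then show "x \<in> (\<Union>x\<in>s ` I. mball x r)" using iI by blast
      qed
      moreover have "finite I" by (simp add: I_def)
      ultimately show "\<exists>L. finite L \<and> L \<subseteq> K \<and> K \<subseteq> (\<Union>x\<in>L. mball x r)"
        using s by (intro exI[of _ "s ` I"]) auto
    qed
    then have "compactin mtopology K"
      using mtotally_bounded_eq_compact_closure_of[of K] complete clK
      by (simp add: mcomplete_of_def closure_of_closedin)
    \<comment> \<open>The whole space is written as a constant intersection to fit
      \<open>measure_Inter_Union_diff_le\<close>.\<close>
    moreover have "measure M ((\<Inter>n::nat. space M) - K) \<le> e"
      unfolding K_def using m B_sets by (intro measure_Inter_Union_diff_le(1)[OF M]) auto
    ultimately show "\<exists>C\<in>{K. compactin (mtopology_of X) K}. C \<subseteq> space M \<and> measure M (space M - C) \<le> e"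
      using KM spM by (intro bexI[of _ K]) (auto simp: mtopology_of_def)
  qed
qed

lemma compactin_Int_Inter:
  assumes "Hausdorff_space T"
  shows "\<And>C D. compactin T C \<Longrightarrow> compactin T D \<Longrightarrow> compactin T (C \<inter> D)"
    and "\<And>C :: nat \<Rightarrow> _. (\<And>i. compactin T (C i)) \<Longrightarrow> compactin T (\<Inter>i. C i)"
proof -
  have cl: "closedin T C" if "compactin T C" for C using assms that by (rule compactin_imp_closedin)
  show "compactin T (C \<inter> D)" if "compactin T C" "compactin T D" for C D
    by (rule closed_compactin[OF that(1)]) (auto intro: closedin_Int cl that)
  show "compactin T (\<Inter>i. C i)" if "\<And>i. compactin T (C i)" for C :: "nat \<Rightarrow> _"
  proof (rule closed_compactin)
    show "closedin T (\<Inter>i. C i)" using cl that by (intro closedin_INT) auto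
    show "compactin T (C 0)" by (rule that)
  qed auto
qed

text \<open>Closed sets inherit the approximation from the whole space by intersection. Open sets of
  a metrizable space are increasing unions of closed ones, so they inherit it by truncation. The
  open sets and their complements then generate the rest.\<close>

lemma inner_approx_compact:
  assumes complete: "mcomplete_of X" and sep: "separable_space (mtopology_of X)"
    and M: "finite_measure M" and sets: "sets M = sets (borel_of (mtopology_of X))"
    and A: "A \<in> sets M"
  shows "inner_approx {K. compactin (mtopology_of X) K} (measure M) A"
proof -
  let ?T = "mtopology_of X" let ?K = "{K. compactin (mtopology_of X) K}"
  interpret finite_measure M by fact
  have spM: "space M = topspace ?T" using sets_eq_imp_space_eq[OF sets] by (simp add: space_borel_of)
  have gen: "sets M = sigma_sets (space M) {U. openin ?T U}" using sets spM by (simp add: sets_borel_of)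
  have closed_sets: "C \<in> sets M" if "closedin ?T C" for C
  proof -
    have "space M - C \<in> sets M" using that gen spM by (auto simp: closedin_def)
    then have "space M - (space M - C) \<in> sets M" by (rule sets.compl_sets)
    moreover have "space M - (space M - C) = C" using closedin_subset[OF that] spM by auto
    ultimately show ?thesis by simp
  qed
  have K_closed: "closedin ?T C" if "compactin ?T C" for C
    using Hausdorff_space_mtopology_of that by (rule compactin_imp_closedin)
  note top = inner_approx_compact_space[OF complete sep M sets]
  have closed: "inner_approx ?K (measure M) F" if F: "closedin ?T F" for F
    unfolding inner_approx_def
  proof (intro allI impI)
    fix e :: real assume "e > 0"
    then obtain C where C: "compactin ?T C" "C \<subseteq> space M" "measure M (space M - C) \<le> e"
      using inner_approxD[OF top] by blast
    have "measure M (F - F \<inter> C) \<le> measure M (space M - C)"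
      using closed_sets K_closed[OF C(1)] closed_sets[OF F] sets.sets_into_space[OF closed_sets[OF F]]
      by (intro finite_measure_mono) auto
    then show "\<exists>C\<in>?K. C \<subseteq> F \<and> measure M (F - C) \<le> e"
      using C by (intro bexI[of _ "F \<inter> C"]) (auto intro: closed_Int_compactin F)
  qed
  have "inner_approx ?K (measure M) U" if U: "openin ?T U" for U
    unfolding inner_approx_def
  proof (intro allI impI)
    fix e :: real assume e: "e > 0"
    have "metrizable_space ?T" by (simp add: mtopology_of_def Metric_space.metrizable_space_mtopology)
    then obtain F where F: "\<And>n. closedin ?T (F n)" "\<And>n. F n \<subseteq> F (Suc n)" "(\<Union>n. F n) = U"
      using open_imp_fsigma_in[OF _ U] unfolding fsigma_in_ascending by blast
    obtain n where n: "measure M ((\<Union>i. F i) - (\<Union>i<n. F i)) \<le> e/2"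
      using exhaust_by_finite_union[where C = F and e = "e/2", OF M closed_sets[OF F(1)]] e by auto
    have cl: "closedin ?T (\<Union>i<n. F i)" using F(1) by (intro closedin_Union) auto
    obtain C where C: "compactin ?T C" "C \<subseteq> (\<Union>i<n. F i)" "measure M ((\<Union>i<n. F i) - C) \<le> e/2"
      using inner_approxD[OF closed[OF cl], of "e/2"] e by auto
    have "measure M (U - C) \<le> measure M (((\<Union>i. F i) - (\<Union>i<n. F i)) \<union> ((\<Union>i<n. F i) - C))"
      using F(3) closed_sets F(1) cl K_closed[OF C(1)] by (intro finite_measure_mono) auto
    also have "\<dots> \<le> measure M ((\<Union>i. F i) - (\<Union>i<n. F i)) + measure M ((\<Union>i<n. F i) - C)"
      using closed_sets F(1) cl K_closed[OF C(1)] by (intro measure_Un_le) auto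
    also have "\<dots> \<le> e" using n C(3) by simp
    finally show "\<exists>C\<in>?K. C \<subseteq> U \<and> measure M (U - C) \<le> e"
      using C F(3) by (intro bexI[of _ C]) auto
  qed
  moreover have "closedin ?T (space M - U)" if "openin ?T U" for U
    using that spM by (metis closedin_diff closedin_topspace)
  moreover note compactin_Int_Inter(2)[OF Hausdorff_space_mtopology_of]
  ultimately show ?thesis
    using top closed K_closed closed_sets
    by (intro inner_approx_sigma_sets[OF M gen _ _ _ _ _ _ _ A]) (auto intro: compactin_Un)
qed

lemma openin_product_countable_union_boxes:
  assumes I: "finite I" and sc: "\<And>i. i \<in> I \<Longrightarrow> second_countable (T i)"
    and U: "openin (product_topology T I) U"
  obtains \<V> where "countable \<V>" "\<And>V i. V \<in> \<V> \<Longrightarrow> i \<in> I \<Longrightarrow> openin (T i) (V i)"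
    "(\<Union>V\<in>\<V>. PiE I V) = U"
proof -
  have "\<forall>i\<in>I. \<exists>B. countable B \<and> (\<forall>V\<in>B. openin (T i) V) \<and>
     (\<forall>U x. openin (T i) U \<and> x \<in> U \<longrightarrow> (\<exists>V\<in>B. x \<in> V \<and> V \<subseteq> U))"
    using sc unfolding second_countable_def by auto
  then obtain B where B: "\<And>i. i \<in> I \<Longrightarrow> countable (B i)"
    "\<And>i V. i \<in> I \<Longrightarrow> V \<in> B i \<Longrightarrow> openin (T i) V"
    "\<And>i U x. i \<in> I \<Longrightarrow> openin (T i) U \<Longrightarrow> x \<in> U \<Longrightarrow> (\<exists>V\<in>B i. x \<in> V \<and> V \<subseteq> U)"
    by metis
  \<comment> \<open>Sides taken from \<open>PiE I B\<close> are fixed outside the finite set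
    \<open>I\<close>, which keeps the family of boxes countable.\<close>
  define \<V> where "\<V> = {V \<in> PiE I B. PiE I V \<subseteq> U}"
  have "countable \<V>" unfolding \<V>_def using countable_PiE[OF I B(1)] by (rule countable_subset[rotated]) auto
  moreover have "openin (T i) (V i)" if "V \<in> \<V>" "i \<in> I" for V i
    using that B(2) by (auto simp: \<V>_def)
  moreover have "U \<subseteq> (\<Union>V\<in>\<V>. PiE I V)"
  proof
    fix x assume x: "x \<in> U"
    obtain W where W: "\<And>i. i \<in> I \<Longrightarrow> openin (T i) (W i)" "x \<in> PiE I W" "PiE I W \<subseteq> U"
      using U x unfolding openin_product_topology_alt by meson
    have "\<forall>i\<in>I. \<exists>V\<in>B i. x i \<in> V \<and> V \<subseteq> W i"
      using W(1,2) B(3) by (auto simp: PiE_iff)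
    then obtain V where V: "\<And>i. i \<in> I \<Longrightarrow> V i \<in> B i" "\<And>i. i \<in> I \<Longrightarrow> x i \<in> V i" "\<And>i. i \<in> I \<Longrightarrow> V i \<subseteq> W i"
      by metis
    have eq: "PiE I (restrict V I) = PiE I V" by (intro PiE_cong) auto
    have "PiE I V \<subseteq> PiE I W" using V(3) by (intro PiE_mono) auto
    then have "restrict V I \<in> \<V>" using V(1) W(3) eq by (auto simp: \<V>_def)
    moreover have "x \<in> PiE I (restrict V I)" using eq V(2) W(2) by (auto simp: PiE_iff)
    ultimately show "x \<in> (\<Union>V\<in>\<V>. PiE I V)" by blast
  qed
  then have "(\<Union>V\<in>\<V>. PiE I V) = U" by (auto simp: \<V>_def)
  ultimately show ?thesis using that by blast
qed

section \<open>Finite products of Polish spaces\<close>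

text \<open>The spaces vary with the index, so metrics, topologies and Borel sets are values
  attached to \<open>k\<close> instead of type class instances.\<close>

locale polish_product =
  fixes N :: "nat set" and X :: "nat \<Rightarrow> 'a metric" and \<mu> :: "nat \<Rightarrow> 'a measure"
  assumes finite_index: "finite N"
    and complete: "\<And>k. k \<in> N \<Longrightarrow> mcomplete_of (X k)"
    and separable: "\<And>k. k \<in> N \<Longrightarrow> separable_space (mtopology_of (X k))"
    and prob: "\<And>k. k \<in> N \<Longrightarrow> prob_space (\<mu> k)"
    and borel: "\<And>k. k \<in> N \<Longrightarrow> sets (\<mu> k) = sets (borel_of (mtopology_of (X k)))"
begin

abbreviation top_prod :: "(nat \<Rightarrow> 'a) topology" where
  "top_prod \<equiv> product_topology (\<lambda>k. mtopology_of (X k)) N"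

definition \<Omega> :: "(nat \<Rightarrow> 'a) set" where
  "\<Omega> = PiE N (\<lambda>k. mspace (X k))"

definition cylinder :: "nat \<Rightarrow> 'a set \<Rightarrow> (nat \<Rightarrow> 'a) set" where
  "cylinder k B = {x \<in> \<Omega>. x k \<in> B}"

lemma subproduct: "S \<subseteq> N \<Longrightarrow> polish_product S X \<mu>"
  using finite_index complete separable prob borel
  by (auto simp: polish_product_def intro: finite_subset)

lemma space_marginal: "k \<in> N \<Longrightarrow> space (\<mu> k) = mspace (X k)"
  using sets_eq_imp_space_eq[OF borel] by (simp add: space_borel_of)

lemma space_product: "space (PiM N \<mu>) = \<Omega>"
  unfolding \<Omega>_def space_PiM by (intro PiE_cong) (simp add: space_marginal)

lemma topspace_top_prod: "topspace top_prod = \<Omega>"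
  by (simp add: \<Omega>_def)

lemma Hausdorff_top_prod: "Hausdorff_space top_prod"
  by (simp add: Hausdorff_space_product_topology Hausdorff_space_mtopology_of)

lemma openin_marginal_sets:
  assumes "k \<in> N" "openin (mtopology_of (X k)) U"
  shows "U \<in> sets (\<mu> k)"
  using assms by (simp add: borel sets_borel_of)

text \<open>Measurable boxes are the sets on which a finitely additive function and the plan
  extending it will be known to agree, so open sets are needed in this form and not merely as
  measurable sets.\<close>

lemma openin_top_prod_boxes:
  assumes "openin top_prod U"
  obtains \<V> where "countable \<V>" "\<And>V k. V \<in> \<V> \<Longrightarrow> k \<in> N \<Longrightarrow> V k \<in> sets (\<mu> k)"
    "(\<Union>V\<in>\<V>. PiE N V) = U"
  using openin_product_countable_union_boxes[OF finite_index second_countable_mtopology_of[OF separable] assms]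
    openin_marginal_sets by metis

lemma box_sets: "(\<And>k. k \<in> N \<Longrightarrow> V k \<in> sets (\<mu> k)) \<Longrightarrow> PiE N V \<in> sets (PiM N \<mu>)"
  using finite_index by (intro sets_PiM_I_finite) auto

lemma openin_sets:
  assumes "openin top_prod U"
  shows "U \<in> sets (PiM N \<mu>)"
proof -
  obtain \<V> where "countable \<V>" "\<And>V k. V \<in> \<V> \<Longrightarrow> k \<in> N \<Longrightarrow> V k \<in> sets (\<mu> k)"
    "(\<Union>V\<in>\<V>. PiE N V) = U"
    using openin_top_prod_boxes[OF assms] by blast
  then show ?thesis using box_sets by (auto intro!: sets.countable_UN')
qed

lemma compactin_sets:
  assumes "compactin top_prod C"
  shows "C \<in> sets (PiM N \<mu>)"
proof -
  have "closedin top_prod C" using Hausdorff_top_prod assms by (rule compactin_imp_closedin)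
  then have "\<Omega> - C \<in> sets (PiM N \<mu>)" and "C \<subseteq> \<Omega>"
    using openin_sets topspace_top_prod by (auto simp: closedin_def)
  then have "\<Omega> - (\<Omega> - C) \<in> sets (PiM N \<mu>)" using sets.compl_sets[of "\<Omega> - C" "PiM N \<mu>"] by (simp add: space_product)
  moreover have "\<Omega> - (\<Omega> - C) = C" using \<open>C \<subseteq> \<Omega>\<close> by auto
  ultimately show ?thesis by simp
qed

lemma cylinder_sets: "k \<in> N \<Longrightarrow> B \<in> sets (\<mu> k) \<Longrightarrow> cylinder k B \<in> sets (PiM N \<mu>)"
  unfolding cylinder_def space_product[symmetric]
  by (rule measurable_sets_Collect[OF measurable_component_singleton]) simp_all

lemma sets_product_cylinders:
  "sets (PiM N \<mu>) = sigma_sets \<Omega> {cylinder k B | k B. k \<in> N \<and> B \<in> sets (\<mu> k)}"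
  using sets_PiM_single[of N \<mu>] by (simp add: cylinder_def space_product[symmetric] space_PiM)

lemma cylinder_compl: "k \<in> N \<Longrightarrow> \<Omega> - cylinder k B = cylinder k (space (\<mu> k) - B)"
  by (auto simp: cylinder_def space_marginal) (auto simp: \<Omega>_def)

lemma cylinder_space: "k \<in> N \<Longrightarrow> cylinder k (space (\<mu> k)) = \<Omega>"
  by (auto simp: cylinder_def space_marginal) (auto simp: \<Omega>_def)

text \<open>Approximating \<open>B\<close> in coordinate \<open>k\<close> and the whole space in
  every other coordinate by compact sets gives a compact box. A point of the cylinder outside the
  box fails in some coordinate, so the loss is controlled by the marginals alone. The class
  \<open>\<S>\<close> allows two uses: all sets for a finitely additive function, the measurable
  sets for a plan.\<close>

lemma inner_approx_cylinder:
  assumes bound: "\<And>A D. A \<in> \<S> \<Longrightarrow> (\<And>i. i \<in> N \<Longrightarrow> D i \<in> sets (\<mu> i)) \<Longrightarrow>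
      A \<subseteq> (\<Union>i\<in>N. cylinder i (D i)) \<Longrightarrow> \<nu> A \<le> (\<Sum>i\<in>N. measure (\<mu> i) (D i))"
    and diff: "\<And>C. compactin top_prod C \<Longrightarrow> cylinder k B - C \<in> \<S>"
    and k: "k \<in> N" and B: "B \<in> sets (\<mu> k)"
  shows "inner_approx {K. compactin top_prod K} \<nu> (cylinder k B)"
  unfolding inner_approx_def
proof (intro allI impI)
  fix e :: real assume e: "e > 0"
  have card: "card N > 0" using k finite_index by (auto simp: card_gt_0_iff)
  define A where "A i = (if i = k then B else space (\<mu> i))" for i
  have A: "A i \<in> sets (\<mu> i)" if "i \<in> N" for i using that B by (auto simp: A_def)
  have "\<forall>i\<in>N. \<exists>C. compactin (mtopology_of (X i)) C \<and> C \<subseteq> A i \<and> measure (\<mu> i) (A i - C) \<le> e / card N"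
  proof
    fix i assume i: "i \<in> N"
    interpret prob_space "\<mu> i" using prob[OF i] .
    have "finite_measure (\<mu> i)" by unfold_locales
    from inner_approx_compact[OF complete[OF i] separable[OF i] this borel[OF i] A[OF i]]
    show "\<exists>C. compactin (mtopology_of (X i)) C \<and> C \<subseteq> A i \<and> measure (\<mu> i) (A i - C) \<le> e / card N"
      using e card by (auto simp: inner_approx_def)
  qed
  then obtain C where C: "\<And>i. i \<in> N \<Longrightarrow> compactin (mtopology_of (X i)) (C i)"
    "\<And>i. i \<in> N \<Longrightarrow> C i \<subseteq> A i" "\<And>i. i \<in> N \<Longrightarrow> measure (\<mu> i) (A i - C i) \<le> e / card N"
    by metis
  have C_sets: "C i \<in> sets (\<mu> i)" if i: "i \<in> N" for i
  proof -
    have cl: "closedin (mtopology_of (X i)) (C i)"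
      using Hausdorff_space_mtopology_of C(1)[OF i] by (rule compactin_imp_closedin)
    then have "space (\<mu> i) - C i \<in> sets (\<mu> i)"
      using openin_marginal_sets[OF i] space_marginal[OF i] by (auto simp: closedin_def)
    then have "space (\<mu> i) - (space (\<mu> i) - C i) \<in> sets (\<mu> i)" by (rule sets.compl_sets)
    moreover have "space (\<mu> i) - (space (\<mu> i) - C i) = C i"
      using closedin_subset[OF cl] space_marginal[OF i] by auto
    ultimately show ?thesis by simp
  qed
  have comp: "compactin top_prod (PiE N C)" using C(1) by (simp add: compactin_PiE)
  have "cylinder k B - PiE N C \<subseteq> (\<Union>i\<in>N. cylinder i (A i - C i))"
  proof
    fix x assume x: "x \<in> cylinder k B - PiE N C"
    then obtain i where i: "i \<in> N" "x i \<notin> C i" by (auto simp: cylinder_def \<Omega>_def PiE_iff)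
    have "x i \<in> A i" using x i by (auto simp: cylinder_def A_def \<Omega>_def space_marginal)
    then show "x \<in> (\<Union>i\<in>N. cylinder i (A i - C i))" using x i by (auto simp: cylinder_def)
  qed
  then have "\<nu> (cylinder k B - PiE N C) \<le> (\<Sum>i\<in>N. measure (\<mu> i) (A i - C i))"
    using A C_sets by (intro bound diff comp) auto
  also have "\<dots> \<le> (\<Sum>i\<in>N. e / card N)" by (intro sum_mono C)
  also have "\<dots> = e" using card by simp
  finally have "\<nu> (cylinder k B - PiE N C) \<le> e" .
  moreover have "PiE N C \<subseteq> cylinder k B"
  proof
    fix x assume x: "x \<in> PiE N C"
    then have "x \<in> topspace top_prod" using comp by (auto simp: compactin_def)
    moreover have "x k \<in> B" using x k C(2)[OF k] by (auto simp: A_def)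
    ultimately show "x \<in> cylinder k B" using topspace_top_prod by (auto simp: cylinder_def)
  qed
  ultimately show "\<exists>C\<in>{K. compactin top_prod K}. C \<subseteq> cylinder k B \<and> \<nu> (cylinder k B - C) \<le> e"
    using comp by blast
qed

text \<open>Complements of cylinders are cylinders, so \<open>inner_approx_cylinder\<close> supplies
  both requirements on the generators in \<open>inner_approx_sigma_sets\<close>.\<close>

lemma plan_inner_approx_compact:
  assumes ne: "N \<noteq> {}" and lam: "lam \<in> plans \<mu> N" and A: "A \<in> sets lam"
  shows "inner_approx {K. compactin top_prod K} (measure lam) A"
proof -
  interpret prob_space lam using lam by (simp add: plans_def)
  have sets: "sets lam = sets (PiM N \<mu>)" using lam by (simp add: plans_def)
  have sp: "space lam = \<Omega>" using sets_eq_imp_space_eq[OF sets] space_product by simp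
  have gen: "sets lam = sigma_sets (space lam) {cylinder k B | k B. k \<in> N \<and> B \<in> sets (\<mu> k)}"
    using sets sp sets_product_cylinders by simp
  have marg: "measure lam (cylinder k B) = measure (\<mu> k) B" if k: "k \<in> N" and B: "B \<in> sets (\<mu> k)" for k B
  proof -
    have "measure (\<mu> k) B = measure (distr lam (\<mu> k) (\<lambda>x. x k)) B"
      using lam k by (simp add: plans_def)
    also have "\<dots> = measure lam ((\<lambda>x. x k) -` B \<inter> space lam)"
      using k B by (intro measure_distr) (auto simp: measurable_cong_sets[OF sets refl])
    also have "(\<lambda>x. x k) -` B \<inter> space lam = cylinder k B" by (auto simp: cylinder_def sp)
    finally show ?thesis by simp
  qed
  have bound: "measure lam A \<le> (\<Sum>i\<in>N. measure (\<mu> i) (D i))"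
    if "A \<in> sets lam" "\<And>i. i \<in> N \<Longrightarrow> D i \<in> sets (\<mu> i)" "A \<subseteq> (\<Union>i\<in>N. cylinder i (D i))" for A D
  proof -
    have cyl: "cylinder i (D i) \<in> sets lam" if "i \<in> N" for i
      using cylinder_sets[OF that] \<open>\<And>i. i \<in> N \<Longrightarrow> D i \<in> sets (\<mu> i)\<close> that sets by simp
    have "measure lam A \<le> measure lam (\<Union>i\<in>N. cylinder i (D i))"
      using that cyl finite_index by (intro finite_measure_mono) auto
    also have "\<dots> \<le> (\<Sum>i\<in>N. measure lam (cylinder i (D i)))"
      using cyl finite_index by (intro finite_measure_subadditive_finite) auto
    also have "\<dots> = (\<Sum>i\<in>N. measure (\<mu> i) (D i))" using that marg by (intro sum.cong) auto
    finally show ?thesis .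
  qed
  have cyl: "inner_approx {K. compactin top_prod K} (measure lam) (cylinder k B)"
    if "k \<in> N" "B \<in> sets (\<mu> k)" for k B
    using that bound cylinder_sets compactin_sets sets
    by (intro inner_approx_cylinder[where \<S> = "sets lam"]) auto
  obtain k where k: "k \<in> N" using ne by auto
  have fin: "finite_measure lam" by unfold_locales
  show ?thesis
  proof (rule inner_approx_sigma_sets[OF fin gen _ _ _ _ _ _ _ A])
    show "inner_approx {K. compactin top_prod K} (measure lam) (space lam)"
      using cyl[OF k sets.top] cylinder_space[OF k] sp by simp
    show "\<And>B. B \<in> {cylinder k B |k B. k \<in> N \<and> B \<in> sets (\<mu> k)} \<Longrightarrow>
         inner_approx {K. compactin top_prod K} (measure lam) (space lam - B)"
      using cyl sp by (auto simp: cylinder_compl)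
    show "(\<Inter>i. C i) \<in> {K. compactin top_prod K}" if "\<And>i. C i \<in> {K. compactin top_prod K}"
      for C :: "nat \<Rightarrow> _"
      using that compactin_Int_Inter(2)[OF Hausdorff_top_prod, of C] by simp
  qed (use cyl compactin_sets sets in \<open>auto intro: compactin_Un\<close>)
qed

end

section \<open>Duality\<close>

lemma compact_nest_empty:
  fixes C :: "nat \<Rightarrow> 'b set"
  assumes T: "Hausdorff_space T" and C: "\<And>n. compactin T (C n)" and dec: "decseq C"
    and empty: "(\<Inter>n. C n) = {}"
  obtains n where "C n = {}"
proof -
  have "\<exists>n. C n = {}"
  proof (rule ccontr)
    assume ne: "\<nexists>n. C n = {}"
    have "compact_space (subtopology T (C 0))" using C[of 0] by (simp add: compactin_subspace)
    moreover have "closedin (subtopology T (C 0)) (C n)" for n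
      using compactin_imp_closedin[OF T C[of n]] decseqD[OF dec, of 0 n]
      by (auto simp: closedin_subtopology)
    ultimately have "(\<Inter>n. C n) \<noteq> {}" using ne dec by (intro compact_space_imp_nest) auto
    then show False using empty by simp
  qed
  then show ?thesis using that by blast
qed

context polish_product
begin

text \<open>By tightness of the marginals, \<open>\<nu>\<close> is countably additive on the algebra of the sets which,
  together with their complements, can be approximated from inside by compact sets.\<close>

theorem finitely_additive_extension:
  fixes \<nu> :: "(nat \<Rightarrow> 'a) set \<Rightarrow> real"
  assumes ne: "N \<noteq> {}" and nonneg: "\<And>A. 0 \<le> \<nu> A"
    and add: "\<And>A B. A \<inter> B = {} \<Longrightarrow> \<nu> (A \<union> B) = \<nu> A + \<nu> B"
    and marg: "\<And>k B. k \<in> N \<Longrightarrow> B \<in> sets (\<mu> k) \<Longrightarrow> \<nu> (cylinder k B) = measure (\<mu> k) B"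
  shows "\<exists>lam\<in>plans \<mu> N. \<forall>V. (\<forall>k\<in>N. V k \<in> sets (\<mu> k)) \<longrightarrow> measure lam (PiE N V) = \<nu> (PiE N V)"
proof -
  let ?K = "{K. compactin top_prod K}"
  have empty: "\<nu> {} = 0" using add[of "{}" "{}"] by simp
  have mono: "\<nu> A \<le> \<nu> B" if "A \<subseteq> B" for A B
  proof -
    have "\<nu> (A \<union> (B - A)) = \<nu> A + \<nu> (B - A)" by (intro add) auto
    moreover have "A \<union> (B - A) = B" using that by auto
    ultimately show ?thesis using nonneg[of "B - A"] by simp
  qed
  have sub: "\<nu> (A \<union> B) \<le> \<nu> A + \<nu> B" for A B
  proof -
    have "\<nu> (A \<union> (B - A)) = \<nu> A + \<nu> (B - A)" by (intro add) auto
    moreover have "A \<union> (B - A) = A \<union> B" by auto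
    ultimately show ?thesis using mono[of "B - A" B] by auto
  qed
  have sub_fin: "\<nu> (\<Union>i\<in>F. A i) \<le> (\<Sum>i\<in>F. \<nu> (A i))" if "finite F" for F :: "nat set" and A
    using that
  proof induction
    case (insert i F)
    have "\<nu> (\<Union>i\<in>insert i F. A i) \<le> \<nu> (A i) + \<nu> (\<Union>i\<in>F. A i)" using sub by simp
    then show ?case using insert by simp
  qed (simp add: empty)
  have cyl: "inner_approx ?K \<nu> (cylinder k B)" if "k \<in> N" "B \<in> sets (\<mu> k)" for k B
  proof (rule inner_approx_cylinder[where \<S> = UNIV])
    fix A D assume D: "\<And>i. i \<in> N \<Longrightarrow> D i \<in> sets (\<mu> i)" "A \<subseteq> (\<Union>i\<in>N. cylinder i (D i))"
    have "\<nu> A \<le> (\<Sum>i\<in>N. \<nu> (cylinder i (D i)))"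
      using mono[OF D(2)] sub_fin[OF finite_index, of "\<lambda>i. cylinder i (D i)"] by simp
    then show "\<nu> A \<le> (\<Sum>i\<in>N. measure (\<mu> i) (D i))" using marg D(1) by simp
  qed (use that in auto)
  define \<A> where "\<A> = {A. A \<subseteq> \<Omega> \<and> inner_approx ?K \<nu> A \<and> inner_approx ?K \<nu> (\<Omega> - A)}"
  have cyl_A: "cylinder k B \<in> \<A>" if "k \<in> N" "B \<in> sets (\<mu> k)" for k B
    using cyl[OF that] cyl[OF that(1) sets.compl_sets[OF that(2)]] cylinder_compl[OF that(1)]
    by (auto simp: \<A>_def cylinder_def)
  obtain k0 where k0: "k0 \<in> N" using ne by auto
  have top: "\<Omega> \<in> \<A>" using cyl_A[OF k0 sets.top] cylinder_space[OF k0] by simp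
  have Un: "inner_approx ?K \<nu> (A \<union> B)" if AB: "inner_approx ?K \<nu> A" "inner_approx ?K \<nu> B" for A B
    unfolding inner_approx_def
  proof (intro allI impI)
    fix e :: real assume "e > 0"
    then have "e/2 > 0" by simp
    obtain C where C: "compactin top_prod C" "C \<subseteq> A" "\<nu> (A - C) \<le> e/2"
      using inner_approxD[OF AB(1) \<open>e/2 > 0\<close>] by blast
    obtain D where D: "compactin top_prod D" "D \<subseteq> B" "\<nu> (B - D) \<le> e/2"
      using inner_approxD[OF AB(2) \<open>e/2 > 0\<close>] by blast
    note CD = C D
    have "\<nu> (A \<union> B - (C \<union> D)) \<le> \<nu> ((A - C) \<union> (B - D))" by (intro mono) auto
    also have "\<dots> \<le> e" using sub[of "A - C" "B - D"] CD by simp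
    finally show "\<exists>C\<in>?K. C \<subseteq> A \<union> B \<and> \<nu> (A \<union> B - C) \<le> e"
      using CD by (intro bexI[of _ "C \<union> D"]) (auto intro: compactin_Un)
  qed
  have Int: "inner_approx ?K \<nu> (A \<inter> B)" if AB: "inner_approx ?K \<nu> A" "inner_approx ?K \<nu> B" for A B
    unfolding inner_approx_def
  proof (intro allI impI)
    fix e :: real assume "e > 0"
    then have "e/2 > 0" by simp
    obtain C where C: "compactin top_prod C" "C \<subseteq> A" "\<nu> (A - C) \<le> e/2"
      using inner_approxD[OF AB(1) \<open>e/2 > 0\<close>] by blast
    obtain D where D: "compactin top_prod D" "D \<subseteq> B" "\<nu> (B - D) \<le> e/2"
      using inner_approxD[OF AB(2) \<open>e/2 > 0\<close>] by blast
    note CD = C D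
    have "\<nu> (A \<inter> B - C \<inter> D) \<le> \<nu> ((A - C) \<union> (B - D))" by (intro mono) auto
    also have "\<dots> \<le> e" using sub[of "A - C" "B - D"] CD by simp
    finally show "\<exists>C\<in>?K. C \<subseteq> A \<inter> B \<and> \<nu> (A \<inter> B - C) \<le> e"
      using CD compactin_Int_Inter(1)[OF Hausdorff_top_prod] by (intro bexI[of _ "C \<inter> D"]) auto
  qed
  have compl: "\<Omega> - A \<in> \<A>" if "A \<in> \<A>" for A
  proof -
    have "\<Omega> - (\<Omega> - A) = A" using that by (auto simp: \<A>_def)
    then show ?thesis using that by (auto simp: \<A>_def)
  qed
  interpret A: algebra \<Omega> \<A>
    unfolding algebra_iff_Un
  proof (intro conjI ballI)
    show "\<A> \<subseteq> Pow \<Omega>" by (auto simp: \<A>_def)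
    show "{} \<in> \<A>" using compl[OF top] by simp
    show "A \<union> B \<in> \<A>" if "A \<in> \<A>" "B \<in> \<A>" for A B
    proof -
      have "\<Omega> - (A \<union> B) = (\<Omega> - A) \<inter> (\<Omega> - B)" by auto
      then show ?thesis using that Un Int by (auto simp: \<A>_def)
    qed
  qed (fact compl)
  have "\<exists>m :: (nat \<Rightarrow> 'a) set \<Rightarrow> ennreal. (\<forall>s\<in>\<A>. m s = ennreal (\<nu> s)) \<and> measure_space \<Omega> (sigma_sets \<Omega> \<A>) m"
  \<comment> \<open>For a finite, finitely additive function on an algebra, countable additivity
    reduces to continuity along sequences decreasing to the empty set.\<close>
  proof (rule A.caratheodory_empty_continuous)
    show "positive \<A> (\<lambda>A. ennreal (\<nu> A))" by (simp add: positive_def empty)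
    show "additive \<A> (\<lambda>A. ennreal (\<nu> A))" by (simp add: additive_def add nonneg)
    fix A :: "nat \<Rightarrow> (nat \<Rightarrow> 'a) set"
    assume A: "range A \<subseteq> \<A>" "decseq A" "(\<Inter>i. A i) = {}"
    have small: "\<exists>n. \<nu> (A n) \<le> e" if e: "e > 0" for e
    proof -
      have "\<exists>C. compactin top_prod C \<and> C \<subseteq> A i \<and> \<nu> (A i - C) \<le> e * (1/2) ^ Suc i" for i
      proof -
        have "inner_approx ?K \<nu> (A i)" using A(1) by (auto simp: \<A>_def)
        then show ?thesis by (rule inner_approxD[of _ _ _ "e * (1/2) ^ Suc i"]) (use e in auto)
      qed
      then obtain C where C: "\<And>i. compactin top_prod (C i)" "\<And>i. C i \<subseteq> A i"
        "\<And>i. \<nu> (A i - C i) \<le> e * (1/2) ^ Suc i" by metis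
      \<comment> \<open>The sets \<open>C i\<close> need not decrease, but their finite
        intersections do, and these shrink to the empty set. By compactness some \<open>D n\<close>
        is empty, so every point of \<open>A n\<close> lies in one of the \<open>A i - C i\<close>
        with \<open>i \<le> n\<close>, and the geometric errors bound
        \<open>\<nu> (A n)\<close>.\<close>
      define D where "D n = (\<Inter>i\<le>n. C i)" for n
      have D: "compactin top_prod (D n)" for n
      proof (induction n)
        case (Suc n)
        have "D (Suc n) = D n \<inter> C (Suc n)" by (auto simp: D_def atMost_Suc)
        then show ?case using compactin_Int_Inter(1)[OF Hausdorff_top_prod Suc C(1)] by simp
      qed (simp add: D_def C)
      have "decseq D" by (auto simp: decseq_def D_def)
      moreover have "D i \<subseteq> A i" for i using C(2)[of i] by (auto simp: D_def)
      then have "(\<Inter>n. D n) \<subseteq> (\<Inter>n. A n)" by (intro INF_mono) blast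
      then have "(\<Inter>n. D n) = {}" unfolding A(3) by (rule subset_empty[THEN iffD1])
      ultimately obtain n where n: "D n = {}"
        using compact_nest_empty[where C = D, OF Hausdorff_top_prod D] by blast
      have "A n \<subseteq> (\<Union>i\<in>{..n}. A i - C i)"
      proof
        fix x assume x: "x \<in> A n"
        obtain i where "i \<le> n" "x \<notin> C i" using n by (auto simp: D_def)
        then show "x \<in> (\<Union>i\<in>{..n}. A i - C i)" using x decseqD[OF A(2), of i n] by auto
      qed
      then have "\<nu> (A n) \<le> (\<Sum>i\<in>{..n}. \<nu> (A i - C i))"
        using sub_fin[of "{..n}" "\<lambda>i. A i - C i"] mono by (meson finite_atMost order_trans)
      also have "\<dots> \<le> (\<Sum>i\<in>{..n}. e * (1/2) ^ Suc i)" by (intro sum_mono C)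
      also have "\<dots> \<le> e"
        using sum_le_suminf[OF sums_summable[OF sums_geometric_half[of e]], of "{..n}"] e
          sums_geometric_half[of e] by (simp add: sums_iff)
      finally show ?thesis by blast
    qed
    have "(\<lambda>i. \<nu> (A i)) \<longlonglongrightarrow> 0"
    proof (rule LIMSEQ_I)
      fix r :: real assume "r > 0"
      then obtain n where n: "\<nu> (A n) \<le> r/2" using small[of "r/2"] by auto
      have "norm (\<nu> (A i) - 0) < r" if "i \<ge> n" for i
        using mono[OF decseqD[OF A(2) that]] n nonneg[of "A i"] \<open>r > 0\<close> by simp
      then show "\<exists>no. \<forall>i\<ge>no. norm (\<nu> (A i) - 0) < r" by blast
    qed
    then show "(\<lambda>i. ennreal (\<nu> (A i))) \<longlonglongrightarrow> 0" using tendsto_ennrealI by fastforce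
  qed simp
  then obtain m where m: "\<And>s. s \<in> \<A> \<Longrightarrow> m s = ennreal (\<nu> s)"
    and ms: "measure_space \<Omega> (sigma_sets \<Omega> \<A>) m" by blast
  define M0 where "M0 = measure_of \<Omega> (sigma_sets \<Omega> \<A>) m"
  have sa: "sigma_algebra \<Omega> (sigma_sets \<Omega> \<A>)" using ms by (simp add: measure_space_def)
  have M0: "sets M0 = sigma_sets \<Omega> \<A>" "space M0 = \<Omega>"
    unfolding M0_def
    by (rule sigma_algebra.sets_measure_of_eq[OF sa], rule sigma_algebra.space_measure_of_eq[OF sa])
  have em0: "emeasure M0 A = m A" if "A \<in> sigma_sets \<Omega> \<A>" for A
    unfolding M0_def using ms that by (intro emeasure_measure_of_sigma) (auto simp: measure_space_def)
  have sub_sets: "sets (PiM N \<mu>) \<subseteq> sigma_sets \<Omega> \<A>"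
    unfolding sets_product_cylinders by (rule sigma_sets_mono') (auto intro: cyl_A)
  \<comment> \<open>The sigma-algebra generated by \<open>\<A>\<close> contains the product
    sigma-algebra but may be larger; the image under the identity restricts the measure to the sets
    that a plan must have.\<close>
  define lam where "lam = distr M0 (PiM N \<mu>) (\<lambda>x. x)"
  have id: "(\<lambda>x. x) \<in> M0 \<rightarrow>\<^sub>M PiM N \<mu>"
    using sub_sets M0 by (auto simp: measurable_def space_product Int_absorb2 dest: sets.sets_into_space)
  have em: "emeasure lam A = ennreal (\<nu> A)" if "A \<in> \<A>" "A \<in> sets (PiM N \<mu>)" for A
  proof -
    have "emeasure lam A = emeasure M0 ((\<lambda>x. x) -` A \<inter> space M0)"
      unfolding lam_def using id that(2) by (rule emeasure_distr)
    also have "(\<lambda>x. x) -` A \<inter> space M0 = A" using that(1) M0(2) by (auto simp: \<A>_def)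
    finally show ?thesis using em0[of A] m[OF that(1)] that(1) by auto
  qed
  have sets: "sets lam = sets (PiM N \<mu>)" and sp: "space lam = \<Omega>"
    by (simp_all add: lam_def space_product)
  have em_cyl: "emeasure lam (cylinder k B) = emeasure (\<mu> k) B" if k: "k \<in> N" and B: "B \<in> sets (\<mu> k)" for k B
  proof -
    interpret prob_space "\<mu> k" using prob[OF k] .
    show ?thesis using em[OF cyl_A[OF that] cylinder_sets[OF that]] marg[OF that]
      by (simp add: emeasure_eq_measure)
  qed
  have "prob_space lam"
  proof
    interpret prob_space "\<mu> k0" using prob[OF k0] .
    show "emeasure lam (space lam) = 1"
      using em_cyl[OF k0 sets.top] cylinder_space[OF k0] sp emeasure_space_1 by simp
  qed
  moreover have "distr lam (\<mu> k) (\<lambda>x. x k) = \<mu> k" if k: "k \<in> N" for k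
  proof (rule measure_eqI)
    fix B assume "B \<in> sets (distr lam (\<mu> k) (\<lambda>x. x k))"
    then have B: "B \<in> sets (\<mu> k)" by simp
    have "emeasure (distr lam (\<mu> k) (\<lambda>x. x k)) B = emeasure lam ((\<lambda>x. x k) -` B \<inter> space lam)"
      using k B by (intro emeasure_distr) (auto simp: measurable_cong_sets[OF sets refl])
    also have "(\<lambda>x. x k) -` B \<inter> space lam = cylinder k B" by (auto simp: cylinder_def sp)
    finally show "emeasure (distr lam (\<mu> k) (\<lambda>x. x k)) B = emeasure (\<mu> k) B" using em_cyl[OF k B] by simp
  qed simp
  ultimately have "lam \<in> plans \<mu> N" using sets by (simp add: plans_def)
  moreover have "measure lam (PiE N V) = \<nu> (PiE N V)" if V: "\<forall>k\<in>N. V k \<in> sets (\<mu> k)" for V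
  proof -
    \<comment> \<open>Boxes are finite intersections of cylinders and thus belong to
      \<open>\<A>\<close>. As \<open>N\<close> is nonempty, the intersection stays inside
      \<open>\<Omega>\<close>.\<close>
    have "PiE N V = (\<Inter>k\<in>N. cylinder k (V k))"
    proof (intro set_eqI iffI)
      fix x assume x: "x \<in> PiE N V"
      have "V k \<subseteq> mspace (X k)" if "k \<in> N" for k
        using that V sets.sets_into_space space_marginal by metis
      then have "x \<in> \<Omega>" unfolding \<Omega>_def using x PiE_mono[of N V "\<lambda>k. mspace (X k)"] by auto
      then show "x \<in> (\<Inter>k\<in>N. cylinder k (V k))" using x by (auto simp: cylinder_def)
    next
      fix x assume x: "x \<in> (\<Inter>k\<in>N. cylinder k (V k))"
      then have "x \<in> \<Omega>" "\<forall>k\<in>N. x k \<in> V k" using k0 by (auto simp: cylinder_def)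
      then show "x \<in> PiE N V" by (simp add: \<Omega>_def PiE_iff)
    qed
    also have "\<dots> \<in> \<A>" using finite_index ne V cyl_A by (intro A.finite_INT) auto
    finally have "emeasure lam (PiE N V) = ennreal (\<nu> (PiE N V))" using V by (intro em box_sets) auto
    then show ?thesis using nonneg by (simp add: measure_def)
  qed
  ultimately show ?thesis by blast
qed

text \<open>The core of Kellerer's duality theorem; the bound \<open>t * f\<close> in the sublinear functional forces
  the resulting plan to live on the zero set of \<open>f\<close>.\<close>

theorem plan_with_vanishing_slack:
  fixes f :: "(nat \<Rightarrow> 'a) \<Rightarrow> real"
  assumes ne: "N \<noteq> {}" and f_nonneg: "\<And>x. x \<in> \<Omega> \<Longrightarrow> 0 \<le> f x"
    and boxes: "\<And>s::real. \<exists>\<V>. countable \<V> \<and> (\<forall>V\<in>\<V>. \<forall>k\<in>N. V k \<in> sets (\<mu> k)) \<and>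
                  {x\<in>\<Omega>. s < f x} = (\<Union>V\<in>\<V>. PiE N V)"
    and dual: "\<And>\<psi>. (\<And>k. k \<in> N \<Longrightarrow> integrable (\<mu> k) (\<psi> k)) \<Longrightarrow>
        (\<And>x. x \<in> \<Omega> \<Longrightarrow> (\<Sum>k\<in>N. \<psi> k (x k)) \<le> f x) \<Longrightarrow> (\<Sum>k\<in>N. \<integral>y. \<psi> k y \<partial>\<mu> k) \<le> 0"
  shows "\<exists>lam\<in>plans \<mu> N. AE x in lam. f x = 0"
proof -
  define E :: "((nat \<Rightarrow> 'a) \<Rightarrow> real) set" where "E = {h. \<exists>M. \<forall>x\<in>\<Omega>. \<bar>h x\<bar> \<le> M}"
  define adm where "adm h = {\<psi>. (\<forall>k\<in>N. integrable (\<mu> k) (\<psi> k)) \<and>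
      (\<exists>t\<ge>0. \<forall>x\<in>\<Omega>. h x \<le> (\<Sum>k\<in>N. \<psi> k (x k)) + t * f x)}" for h :: "(nat \<Rightarrow> 'a) \<Rightarrow> real"
  define v where "v \<psi> = (\<Sum>k\<in>N. \<integral>y. \<psi> k y \<partial>\<mu> k)" for \<psi> :: "nat \<Rightarrow> 'a \<Rightarrow> real"
  define p where "p h = (INF \<psi>\<in>adm h. v \<psi>)" for h
  have card: "card N > 0" using ne finite_index by (auto simp: card_gt_0_iff)
  have int_const: "integrable (\<mu> k) (\<lambda>_. c)" "(\<integral>y. c \<partial>\<mu> k) = c" if "k \<in> N" for k and c :: real
  proof -
    interpret prob_space "\<mu> k" using prob[OF that] .
    show "integrable (\<mu> k) (\<lambda>_. c)" "(\<integral>y. c \<partial>\<mu> k) = c" by (simp_all add: prob_space)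
  qed
  have scaleE: "(\<lambda>x. t * h x) \<in> E" if "h \<in> E" for h t
  proof -
    obtain M where "\<And>x. x \<in> \<Omega> \<Longrightarrow> \<bar>h x\<bar> \<le> M" using \<open>h \<in> E\<close> by (auto simp: E_def)
    then have "\<bar>t * h x\<bar> \<le> \<bar>t\<bar> * M" if "x \<in> \<Omega>" for x using that by (simp add: abs_mult mult_left_mono)
    then show ?thesis by (auto simp: E_def)
  qed
  have addE: "(\<lambda>x. g x + h x) \<in> E" if "g \<in> E" "h \<in> E" for g h
  proof -
    obtain M where "\<And>x. x \<in> \<Omega> \<Longrightarrow> \<bar>g x\<bar> \<le> M" using \<open>g \<in> E\<close> by (auto simp: E_def)
    moreover obtain M' where "\<And>x. x \<in> \<Omega> \<Longrightarrow> \<bar>h x\<bar> \<le> M'" using \<open>h \<in> E\<close> by (auto simp: E_def)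
    ultimately have "\<bar>g x + h x\<bar> \<le> M + M'" if "x \<in> \<Omega>" for x using that abs_triangle_ineq[of "g x" "h x"] by fastforce
    then show ?thesis by (auto simp: E_def)
  qed
  have adm_ne: "adm h \<noteq> {}" if "h \<in> E" for h
  proof -
    obtain M where M: "\<And>x. x \<in> \<Omega> \<Longrightarrow> \<bar>h x\<bar> \<le> M" using \<open>h \<in> E\<close> by (auto simp: E_def)
    have "(\<lambda>k y. M / card N) \<in> adm h"
      unfolding adm_def using int_const card M by (auto intro!: exI[of _ 0] simp: abs_le_iff)
    then show ?thesis by blast
  qed
  have adm_ge: "- M \<le> v \<psi>" if psi: "\<psi> \<in> adm h" and M: "\<And>x. x \<in> \<Omega> \<Longrightarrow> \<bar>h x\<bar> \<le> M" for h M \<psi>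
  proof -
    obtain t where t: "t \<ge> 0" "\<And>x. x \<in> \<Omega> \<Longrightarrow> h x \<le> (\<Sum>k\<in>N. \<psi> k (x k)) + t * f x"
      and int: "\<And>k. k \<in> N \<Longrightarrow> integrable (\<mu> k) (\<psi> k)" using psi by (auto simp: adm_def)
    \<comment> \<open>An admissible \<open>\<psi>\<close> of too small value would yield an
      improvement of the dual solution. From \<open>- M \<le> h\<close> one gets
      \<open>- (\<Sum> \<psi> k + M) \<le> t * f \<le> (t + 1) * f\<close>, and the division by
      \<open>t + 1\<close> also covers \<open>t = 0\<close>. The constant \<open>M\<close> is shared
      equally among the coordinates.\<close>
    define \<xi> where "\<xi> k y = - (\<psi> k y + M / card N) / (t + 1)" for k y
    have "(\<Sum>k\<in>N. \<integral>y. \<xi> k y \<partial>\<mu> k) \<le> 0"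
    proof (rule dual)
      show "integrable (\<mu> k) (\<xi> k)" if "k \<in> N" for k
        unfolding \<xi>_def using int int_const that by auto
      fix x assume x: "x \<in> \<Omega>"
      have "(\<Sum>k\<in>N. \<xi> k (x k)) = - ((\<Sum>k\<in>N. \<psi> k (x k)) + M) / (t + 1)"
        unfolding \<xi>_def using card
        by (simp add: sum_divide_distrib[symmetric] sum_negf sum.distrib sum_subtractf)
      also have "\<dots> \<le> f x"
      proof -
        have "- ((\<Sum>k\<in>N. \<psi> k (x k)) + M) \<le> t * f x" using t(2)[OF x] M[OF x] by (simp add: abs_le_iff)
        also have "\<dots> \<le> f x * (t + 1)" using f_nonneg[OF x] by (simp add: algebra_simps)
        finally show ?thesis using t(1) by (simp add: divide_le_eq)
      qed
      finally show "(\<Sum>k\<in>N. \<xi> k (x k)) \<le> f x" .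
    qed
    moreover have "(\<Sum>k\<in>N. \<integral>y. \<xi> k y \<partial>\<mu> k) = (\<Sum>k\<in>N. - ((\<integral>y. \<psi> k y \<partial>\<mu> k) + M / card N) / (t + 1))"
      unfolding \<xi>_def using int int_const by (intro sum.cong) auto
    moreover have "\<dots> = - (v \<psi> + M) / (t + 1)"
      unfolding v_def using card by (simp add: sum_divide_distrib[symmetric] sum_negf sum.distrib sum_subtractf)
    ultimately show ?thesis using t(1) by (simp add: divide_le_eq)
  qed
  have p_le: "p h \<le> v \<psi>" if "\<psi> \<in> adm h" "h \<in> E" for h \<psi>
  proof -
    obtain M where "\<And>x. x \<in> \<Omega> \<Longrightarrow> \<bar>h x\<bar> \<le> M" using \<open>h \<in> E\<close> by (auto simp: E_def)
    then show ?thesis unfolding p_def using adm_ge that(1) by (intro cINF_lower bdd_belowI2[of _ "- M"]) auto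
  qed
  have p_ge: "b \<le> p h" if "h \<in> E" "\<And>\<psi>. \<psi> \<in> adm h \<Longrightarrow> b \<le> v \<psi>" for b h
    unfolding p_def using adm_ne that by (intro cINF_greatest) auto
  have p_add: "p (\<lambda>x. g x + h x) \<le> p g + p h" if gh: "g \<in> E" "h \<in> E" for g h
  proof -
    have sum: "p (\<lambda>x. g x + h x) \<le> v \<psi> + v \<xi>" if \<psi>: "\<psi> \<in> adm g" and \<xi>: "\<xi> \<in> adm h" for \<psi> \<xi>
    proof -
      obtain t where t: "t \<ge> 0" "\<And>x. x \<in> \<Omega> \<Longrightarrow> g x \<le> (\<Sum>k\<in>N. \<psi> k (x k)) + t * f x"
        using \<psi> by (auto simp: adm_def)
      obtain s where s: "s \<ge> 0" "\<And>x. x \<in> \<Omega> \<Longrightarrow> h x \<le> (\<Sum>k\<in>N. \<xi> k (x k)) + s * f x"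
        using \<xi> by (auto simp: adm_def)
      have int: "\<And>k. k \<in> N \<Longrightarrow> integrable (\<mu> k) (\<psi> k)" "\<And>k. k \<in> N \<Longrightarrow> integrable (\<mu> k) (\<xi> k)"
        using \<psi> \<xi> by (auto simp: adm_def)
      have "g x + h x \<le> (\<Sum>k\<in>N. \<psi> k (x k) + \<xi> k (x k)) + (t + s) * f x" if "x \<in> \<Omega>" for x
        using t(2)[OF that] s(2)[OF that] by (simp add: sum.distrib algebra_simps)
      then have "(\<lambda>k y. \<psi> k y + \<xi> k y) \<in> adm (\<lambda>x. g x + h x)"
        unfolding adm_def using t(1) s(1) int by (auto intro!: exI[of _ "t + s"])
      then have "p (\<lambda>x. g x + h x) \<le> v (\<lambda>k y. \<psi> k y + \<xi> k y)" by (rule p_le) (intro addE gh)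
      also have "\<dots> = v \<psi> + v \<xi>" unfolding v_def sum.distrib[symmetric] using int by (intro sum.cong) auto
      finally show ?thesis .
    qed
    have "p (\<lambda>x. g x + h x) - v \<psi> \<le> p h" if "\<psi> \<in> adm g" for \<psi>
      by (intro p_ge gh) (use sum[OF that] in \<open>simp add: diff_le_eq add.commute\<close>)
    then have "p (\<lambda>x. g x + h x) - p h \<le> p g"
      by (intro p_ge gh) (simp add: diff_le_eq add.commute)
    then show ?thesis by simp
  qed
  have p_scale: "p (\<lambda>x. t * h x) \<le> t * p h" if h: "h \<in> E" and t: "0 < t" for h t
  proof -
    have "p (\<lambda>x. t * h x) / t \<le> v \<psi>" if \<psi>: "\<psi> \<in> adm h" for \<psi>
    proof -
      obtain s where s: "s \<ge> 0" "\<And>x. x \<in> \<Omega> \<Longrightarrow> h x \<le> (\<Sum>k\<in>N. \<psi> k (x k)) + s * f x"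
        and int: "\<And>k. k \<in> N \<Longrightarrow> integrable (\<mu> k) (\<psi> k)" using \<psi> by (auto simp: adm_def)
      have "t * h x \<le> (\<Sum>k\<in>N. t * \<psi> k (x k)) + (t * s) * f x" if "x \<in> \<Omega>" for x
        using mult_left_mono[OF s(2)[OF that], of t] t by (simp add: sum_distrib_left algebra_simps)
      then have "(\<lambda>k y. t * \<psi> k y) \<in> adm (\<lambda>x. t * h x)"
        unfolding adm_def using t s(1) int by (auto intro!: exI[of _ "t * s"])
      then have "p (\<lambda>x. t * h x) \<le> v (\<lambda>k y. t * \<psi> k y)" by (rule p_le) (intro scaleE h)
      also have "\<dots> = t * v \<psi>" by (simp add: v_def sum_distrib_left)
      finally show ?thesis using t by (simp add: field_simps)
    qed
    then have "p (\<lambda>x. t * h x) / t \<le> p h" by (intro p_ge h)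
    then show ?thesis using t by (simp add: field_simps)
  qed
  obtain l where l_add: "\<And>g h. g \<in> E \<Longrightarrow> h \<in> E \<Longrightarrow> l (\<lambda>x. g x + h x) = l g + l h"
    and l_le: "\<And>h. h \<in> E \<Longrightarrow> l h \<le> p h"
    by (rule sublinear_dominates_additive[of E p]) (rule scaleE addE p_add p_scale that; assumption)+
  have l_le_v: "l h \<le> v \<psi>" if "h \<in> E" "\<And>k. k \<in> N \<Longrightarrow> integrable (\<mu> k) (\<psi> k)" "t \<ge> 0"
      "\<And>x. x \<in> \<Omega> \<Longrightarrow> h x \<le> (\<Sum>k\<in>N. \<psi> k (x k)) + t * f x" for h \<psi> t
  proof -
    have "\<psi> \<in> adm h" using that by (auto simp: adm_def)
    then show ?thesis using p_le[of \<psi> h] l_le[of h] \<open>h \<in> E\<close> by simp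
  qed
  define \<nu> where "\<nu> A = l (indicator A)" for A
  have ind_E: "indicator A \<in> E" "(\<lambda>x. - indicator A x) \<in> E" for A
    by (auto simp: E_def indicator_def intro!: exI[of _ 1])
  have zero: "l (\<lambda>_. 0) = 0"
    using l_add[of "\<lambda>_. 0" "\<lambda>_. 0"] by (auto simp: E_def)
  have neg: "l (\<lambda>x. - indicator A x) = - \<nu> A" for A
    using l_add[OF ind_E(1)[of A] ind_E(2)[of A]] zero by (simp add: \<nu>_def)
  \<comment> \<open>The zero potentials are admissible for the negative of an indicator, so its
    value is at most 0.\<close>
  have nonneg: "0 \<le> \<nu> A" for A
    using l_le_v[OF ind_E(2)[of A], of "\<lambda>_ _. 0" 0] neg[of A] by (simp add: v_def)
  have add: "\<nu> (A \<union> B) = \<nu> A + \<nu> B" if "A \<inter> B = {}" for A B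
  proof -
    have "(\<lambda>x. indicator A x + indicator B x :: real) = indicator (A \<union> B)"
      using that by (auto simp: indicator_def fun_eq_iff)
    then show ?thesis using l_add[OF ind_E(1)[of A] ind_E(1)[of B]] by (simp add: \<nu>_def)
  qed
  have marg: "\<nu> (cylinder k B) = measure (\<mu> k) B" if k: "k \<in> N" and B: "B \<in> sets (\<mu> k)" for k B
  proof -
    interpret prob_space "\<mu> k" using prob[OF k] .
    \<comment> \<open>A potential concentrated on coordinate \<open>k\<close> represents the
      indicator of the cylinder exactly. The factors \<open>r = 1\<close> and \<open>r = -1\<close>
      bound its value from above and from below.\<close>
    define \<psi> where "\<psi> r i y = (if i = k then r * indicator B y else 0 :: real)" for r i y
    have int: "integrable (\<mu> i) (\<psi> r i)" for r i
      unfolding \<psi>_def[abs_def] using B by (cases "i = k") (auto simp: emeasure_eq_measure)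
    have v: "v (\<psi> r) = r * measure (\<mu> k) B" for r
    proof -
      have "v (\<psi> r) = (\<Sum>i\<in>N. if i = k then r * measure (\<mu> k) B else 0)"
        unfolding v_def \<psi>_def using B by (intro sum.cong) auto
      then show ?thesis using k finite_index by simp
    qed
    have val: "(\<Sum>i\<in>N. \<psi> r i (x i)) = r * indicator (cylinder k B) x" if "x \<in> \<Omega>" for r x
      using that k finite_index by (simp add: \<psi>_def indicator_def cylinder_def)
    have "\<nu> (cylinder k B) \<le> measure (\<mu> k) B"
      using l_le_v[OF ind_E(1)[of "cylinder k B"], of "\<psi> 1" 0] int v val by (simp add: \<nu>_def)
    moreover have "- \<nu> (cylinder k B) \<le> - measure (\<mu> k) B"
      using l_le_v[OF ind_E(2)[of "cylinder k B"], of "\<psi> (-1)" 0] int v val neg by simp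
    ultimately show ?thesis by simp
  qed
  obtain lam where lam: "lam \<in> plans \<mu> N"
    and box: "\<And>V. (\<forall>k\<in>N. V k \<in> sets (\<mu> k)) \<Longrightarrow> measure lam (PiE N V) = \<nu> (PiE N V)"
    using finitely_additive_extension[of \<nu>, OF ne nonneg add marg] by blast
  interpret lam: prob_space lam using lam by (simp add: plans_def)
  have sets: "sets lam = sets (PiM N \<mu>)" using lam by (simp add: plans_def)
  have sp: "space lam = \<Omega>" using sets_eq_imp_space_eq[OF sets] space_product by simp
  have null: "{x\<in>\<Omega>. inverse (real (Suc m)) < f x} \<in> null_sets lam" for m
  proof -
    obtain \<V> where V: "countable \<V>" "\<And>V k. V \<in> \<V> \<Longrightarrow> k \<in> N \<Longrightarrow> V k \<in> sets (\<mu> k)"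
      and eq: "{x\<in>\<Omega>. inverse (real (Suc m)) < f x} = (\<Union>V\<in>\<V>. PiE N V)" using boxes by metis
    have "PiE N V \<in> null_sets lam" if "V \<in> \<V>" for V
    proof -
      \<comment> \<open>On this box \<open>f\<close> exceeds \<open>1 / (m + 1)\<close>, so zero
        potentials with \<open>t = m + 1\<close> are admissible for its indicator and force its
        value to be 0.\<close>
      have le: "indicator (PiE N V) x \<le> real (Suc m) * f x" if x: "x \<in> \<Omega>" for x
      proof (cases "x \<in> PiE N V")
        case True
        then have "inverse (real (Suc m)) < f x" using eq \<open>V \<in> \<V>\<close> by blast
        then have "1 < real (Suc m) * f x" by (simp add: field_simps)
        then show ?thesis by (simp add: indicator_def split: if_splits)
      next
        case False
        then show ?thesis using f_nonneg[OF x] by simp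
      qed
      have "\<nu> (PiE N V) \<le> 0"
        using l_le_v[OF ind_E(1)[of "PiE N V"], of "\<lambda>_ _. 0" "real (Suc m)"] le by (simp add: \<nu>_def v_def)
      then have "measure lam (PiE N V) = 0" using box[of V] V(2)[OF that] nonneg[of "PiE N V"] by simp
      then show ?thesis using box_sets V(2)[OF that] sets by (simp add: null_sets_def lam.emeasure_eq_measure)
    qed
    then show ?thesis unfolding eq using V(1) by (intro null_sets_UN') auto
  qed
  have "AE x in lam. f x = 0"
  proof (rule AE_I')
    show "(\<Union>m. {x\<in>\<Omega>. inverse (real (Suc m)) < f x}) \<in> null_sets lam" by (intro null_sets_UN' null) auto
    show "{x \<in> space lam. f x \<noteq> 0} \<subseteq> (\<Union>m. {x\<in>\<Omega>. inverse (real (Suc m)) < f x})"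
    proof
      fix x assume "x \<in> {x \<in> space lam. f x \<noteq> 0}"
      then have "x \<in> \<Omega>" "0 < f x" using f_nonneg[of x] sp by force+
      then show "x \<in> (\<Union>m. {x\<in>\<Omega>. inverse (real (Suc m)) < f x})" using reals_Archimedean by auto
    qed
  qed
  then show ?thesis using lam by blast
qed

end

section \<open>Reduced problems\<close>

lemma ointegral_integrable:
  assumes "integrable M g"
  shows "ointegral M g = ereal (\<integral>x. g x \<partial>M)"
proof -
  have fin: "enn2ereal t = ereal (enn2real t)" if "t \<noteq> \<infinity>" for t
    using that by (cases t) (auto simp: enn2ereal_ennreal)
  show ?thesis
    using assms by (simp add: ointegral_def nn_integral_completion real_lebesgue_integral_def
        fin real_integrable_def)
qed

lemma ointegral_cong_AE:
  assumes "AE x in M. f x = g x"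
  shows "ointegral M f = ointegral M g"
proof -
  have "(\<integral>\<^sup>+x. ennreal (f x) \<partial>M) = (\<integral>\<^sup>+x. ennreal (g x) \<partial>M)"
    "(\<integral>\<^sup>+x. ennreal (- f x) \<partial>M) = (\<integral>\<^sup>+x. ennreal (- g x) \<partial>M)"
    using assms by (auto intro!: nn_integral_cong_AE)
  then show ?thesis by (simp add: ointegral_def nn_integral_completion)
qed

text \<open>Monotonicity of the nonnegative integral holds for arbitrary functions, so
  \<open>h\<close> may be a reduced cost whose measurability is unknown.\<close>

lemma ointegral_ge:
  assumes "integrable M g" "\<And>x. x \<in> space M \<Longrightarrow> g x \<le> h x"
  shows "ereal (\<integral>x. g x \<partial>M) \<le> ointegral M h"
proof -
  have "ointegral M g \<le> ointegral M h"
    unfolding ointegral_def nn_integral_completion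
    using assms(2) by (intro ereal_minus_mono) (auto simp: less_eq_ennreal.rep_eq[symmetric]
        intro!: nn_integral_mono ennreal_leI)
  then show ?thesis by (simp add: ointegral_integrable[OF assms(1)])
qed

text \<open>The bound from above rules out an infinite positive part, so \<open>h\<close> is
  integrable. The nonnegative function \<open>h - g\<close> then has integral 0.\<close>

lemma AE_eq_if_ointegral_le:
  assumes g: "integrable M g" and h: "h \<in> borel_measurable M"
    and le: "\<And>x. x \<in> space M \<Longrightarrow> g x \<le> h x"
    and int: "ointegral M h \<le> ereal (\<integral>x. g x \<partial>M)"
  shows "AE x in M. h x = g x"
proof -
  have "(\<integral>\<^sup>+x. ennreal (- h x) \<partial>M) \<le> (\<integral>\<^sup>+x. ennreal (- g x) \<partial>M)"
    using le by (auto intro!: nn_integral_mono ennreal_leI)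
  then have neg: "(\<integral>\<^sup>+x. ennreal (- h x) \<partial>M) \<noteq> \<infinity>"
    using g by (auto simp: real_integrable_def top_unique)
  have "(\<integral>\<^sup>+x. ennreal (h x) \<partial>M) \<noteq> \<infinity>"
  proof
    assume "(\<integral>\<^sup>+x. ennreal (h x) \<partial>M) = \<infinity>"
    moreover obtain q where "(\<integral>\<^sup>+x. ennreal (- h x) \<partial>M) = ennreal q" "q \<ge> 0"
      using neg by (cases "\<integral>\<^sup>+x. ennreal (- h x) \<partial>M") auto
    ultimately have "ointegral M h = \<infinity>"
      by (simp add: ointegral_def nn_integral_completion enn2ereal_ennreal)
    then show False using int by simp
  qed
  then have ih: "integrable M h" using neg h by (simp add: real_integrable_def)
  then have "(\<integral>x. h x - g x \<partial>M) \<le> 0" using int g by (simp add: ointegral_integrable)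
  moreover have nn: "AE x in M. 0 \<le> h x - g x" using le by (intro AE_I2) simp
  ultimately have "(\<integral>x. h x - g x \<partial>M) = 0" using integral_nonneg_AE[OF nn] by simp
  then have "AE x in M. h x - g x = 0" using integral_nonneg_eq_0_iff_AE[OF _ nn] ih g by simp
  then show ?thesis by (rule AE_mp) simp
qed

section \<open>Marginals and projections of plans\<close>

lemma plan_measurable_component:
  assumes "lam \<in> plans \<mu> S" "k \<in> S"
  shows "(\<lambda>x. x k) \<in> lam \<rightarrow>\<^sub>M \<mu> k"
proof -
  have "sets lam = sets (PiM S \<mu>)" using assms(1) by (simp add: plans_def)
  then show ?thesis using assms(2) by (simp cong: measurable_cong_sets)
qed

lemma plan_integral_separable:
  assumes lam: "lam \<in> plans \<mu> S" and \<phi>: "\<And>k. k \<in> S \<Longrightarrow> integrable (\<mu> k) (\<phi> k)"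
  shows "integrable lam (\<lambda>x. \<Sum>k\<in>S. (\<phi> k (x k) :: real))"
    and "(\<integral>x. (\<Sum>k\<in>S. \<phi> k (x k)) \<partial>lam) = (\<Sum>k\<in>S. \<integral>y. \<phi> k y \<partial>\<mu> k)"
proof -
  have "integrable lam (\<lambda>x. \<phi> k (x k)) \<and> (\<integral>x. \<phi> k (x k) \<partial>lam) = (\<integral>y. \<phi> k y \<partial>\<mu> k)" if k: "k \<in> S" for k
  proof -
    have d: "distr lam (\<mu> k) (\<lambda>x. x k) = \<mu> k" using lam k by (simp add: plans_def)
    have m: "\<phi> k \<in> borel_measurable (\<mu> k)" using \<phi>[OF k] by auto
    show ?thesis
      using integrable_distr_eq[OF plan_measurable_component[OF lam k] m]
        integral_distr[OF plan_measurable_component[OF lam k] m] \<phi>[OF k] d by simp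
  qed
  then show "integrable lam (\<lambda>x. \<Sum>k\<in>S. \<phi> k (x k))"
    and "(\<integral>x. (\<Sum>k\<in>S. \<phi> k (x k)) \<partial>lam) = (\<Sum>k\<in>S. \<integral>y. \<phi> k y \<partial>\<mu> k)" by auto
qed

lemma measurable_restrict_plan:
  assumes "sets lam = sets (PiM N \<mu>)" "S \<subseteq> N"
  shows "(\<lambda>x. restrict x S) \<in> lam \<rightarrow>\<^sub>M PiM S \<mu>"
  using measurable_restrict_subset[OF assms(2), of \<mu>] assms(1) by (simp cong: measurable_cong_sets)

lemma projection_in_plans:
  assumes lam: "lam \<in> plans \<mu> N" and S: "S \<subseteq> N"
  shows "distr lam (PiM S \<mu>) (\<lambda>x. restrict x S) \<in> plans \<mu> S"
proof -
  have sets: "sets lam = sets (PiM N \<mu>)" using lam by (simp add: plans_def)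
  note m = measurable_restrict_plan[OF sets S]
  interpret prob_space lam using lam by (simp add: plans_def)
  have "distr (distr lam (PiM S \<mu>) (\<lambda>x. restrict x S)) (\<mu> k) (\<lambda>x. x k) = \<mu> k" if k: "k \<in> S" for k
  proof -
    have "distr (distr lam (PiM S \<mu>) (\<lambda>x. restrict x S)) (\<mu> k) (\<lambda>x. x k)
        = distr lam (\<mu> k) ((\<lambda>x. x k) \<circ> (\<lambda>x. restrict x S))"
      using k m by (intro distr_distr) auto
    also have "\<dots> = distr lam (\<mu> k) (\<lambda>x. x k)" using k by (simp add: comp_def)
    also have "\<dots> = \<mu> k" using lam k S by (auto simp: plans_def)
    finally show ?thesis .
  qed
  then show ?thesis using prob_space_distr[OF m] by (simp add: plans_def)
qed

context polish_product
begin

text \<open>The image of \<open>A\<close> under the projection need not be measurable. Compact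
  subsets of \<open>A\<close> carrying almost all the mass have compact, hence measurable, images,
  and countably many of them suffice.\<close>

lemma AE_projection:
  assumes ne: "N \<noteq> {}" and lam: "lam \<in> plans \<mu> N" and S: "S \<subseteq> N"
    and A: "A \<in> sets lam" and AE: "AE x in lam. x \<in> A"
  shows "AE y in distr lam (PiM S \<mu>) (\<lambda>x. restrict x S). y \<in> (\<lambda>x. restrict x S) ` A"
proof -
  interpret prob_space lam using lam by (simp add: plans_def)
  interpret S: polish_product S X \<mu> using subproduct[OF S] .
  have sets: "sets lam = sets (PiM N \<mu>)" using lam by (simp add: plans_def)
  have sp: "space lam = \<Omega>" using sets_eq_imp_space_eq[OF sets] space_product by simp
  note m = measurable_restrict_plan[OF sets S]
  have cont: "continuous_map top_prod S.top_prod (\<lambda>x. restrict x S)"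
    unfolding continuous_map_componentwise
  proof (intro conjI ballI)
    fix k assume k: "k \<in> S"
    then have "(\<lambda>x. restrict x S k) = (\<lambda>x. x k)" by auto
    then show "continuous_map top_prod (mtopology_of (X k)) (\<lambda>x. restrict x S k)"
      using k S by (auto intro: continuous_map_product_projection)
  qed auto
  have "\<exists>C. compactin top_prod C \<and> C \<subseteq> A \<and> measure lam (A - C) \<le> inverse (real (Suc n))" for n
  proof -
    have "inner_approx {K. compactin top_prod K} (measure lam) A"
      using plan_inner_approx_compact[OF ne lam A] .
    then show ?thesis by (rule inner_approxD[of _ _ _ "inverse (real (Suc n))"]) auto
  qed
  then obtain C where C: "\<And>n. compactin top_prod (C n)" "\<And>n. C n \<subseteq> A"
    "\<And>n. measure lam (A - C n) \<le> inverse (real (Suc n))" by metis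
  define D where "D = (\<Union>n. (\<lambda>x. restrict x S) ` C n)"
  have D: "D \<in> sets (PiM S \<mu>)"
    unfolding D_def using S.compactin_sets[OF image_compactin[OF C(1) cont]] by auto
  have C_sets: "C n \<in> sets lam" for n using compactin_sets[OF C(1)] sets by simp
  define B where "B = (\<lambda>x. restrict x S) -` D \<inter> space lam"
  have B: "B \<in> sets lam" unfolding B_def using m D by (rule measurable_sets)
  have "prob A = 1" using AE A by (simp add: prob_eq_1)
  have "1 \<le> prob B + inverse (real (Suc n))" for n
  proof -
    have "C n \<subseteq> B" using sets.sets_into_space[OF C_sets[of n]] by (auto simp: B_def D_def)
    then have "prob (C n) \<le> prob B" using B by (intro finite_measure_mono)
    moreover have "prob (A - C n) = prob A - prob (C n)"
      using A C_sets C(2) by (intro finite_measure_Diff) auto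
    ultimately show ?thesis using C(3)[of n] \<open>prob A = 1\<close> by simp
  qed
  then have "(1::real) \<le> prob B + 0"
    by (intro LIMSEQ_le_const[OF tendsto_add[OF tendsto_const LIMSEQ_inverse_real_of_nat]]) auto
  then have "prob B = 1" using prob_le_1[of B] by simp
  then have "AE x in lam. x \<in> B" using B by (simp add: prob_eq_1)
  then have "AE x in lam. restrict x S \<in> D" by (rule AE_mp) (auto simp: B_def)
  then have "AE y in distr lam (PiM S \<mu>) (\<lambda>x. restrict x S). y \<in> D"
    using D m by (subst AE_distr_iff) auto
  then show ?thesis by (rule AE_mp) (use C(2) in \<open>auto simp: D_def\<close>)
qed

end

section \<open>Complementary slackness and optimality for the reduced costs\<close>

locale transport_dual = polish_product N X \<mu>
  for N and X :: "nat \<Rightarrow> 'a metric" and \<mu> +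
  fixes c :: "(nat \<Rightarrow> 'a) \<Rightarrow> real" and \<phi> :: "nat \<Rightarrow> 'a \<Rightarrow> real"
  assumes index_ne: "N \<noteq> {}"
    and cost_lsc: "lsc_on top_prod c"
    and dual_sol: "dual_solution X \<mu> N c \<phi>"
begin

definition slack :: "(nat \<Rightarrow> 'a) \<Rightarrow> real" where
  "slack x = c x - (\<Sum>k\<in>N. \<phi> k (x k))"

lemma \<phi>_integrable: "k \<in> N \<Longrightarrow> integrable (\<mu> k) (\<phi> k)"
  using dual_sol by (simp add: dual_solution_def)

lemma slack_nonneg: "x \<in> \<Omega> \<Longrightarrow> 0 \<le> slack x"
  using dual_sol by (simp add: dual_solution_def slack_def \<Omega>_def)

text \<open>Adding \<open>\<psi>\<close> to \<open>\<phi>\<close> gives a competitor in the dual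
  problem, so a positive total would contradict the optimality of \<open>\<phi>\<close>.\<close>

lemma slack_dual:
  assumes "\<And>k. k \<in> N \<Longrightarrow> integrable (\<mu> k) (\<psi> k)"
    and "\<And>x. x \<in> \<Omega> \<Longrightarrow> (\<Sum>k\<in>N. \<psi> k (x k)) \<le> slack x"
  shows "(\<Sum>k\<in>N. \<integral>y. \<psi> k y \<partial>\<mu> k) \<le> 0"
proof -
  let ?\<xi> = "\<lambda>k y. \<phi> k y + \<psi> k y"
  have "\<forall>k\<in>N. integrable (\<mu> k) (?\<xi> k)" using assms(1) \<phi>_integrable by auto
  moreover have "\<forall>x\<in>PiE N (\<lambda>k. mspace (X k)). (\<Sum>k\<in>N. ?\<xi> k (x k)) \<le> c x"
  proof
    fix x assume "x \<in> PiE N (\<lambda>k. mspace (X k))"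
    then have "(\<Sum>k\<in>N. \<psi> k (x k)) \<le> slack x" by (intro assms(2)) (simp add: \<Omega>_def)
    then show "(\<Sum>k\<in>N. ?\<xi> k (x k)) \<le> c x" by (simp add: slack_def sum.distrib)
  qed
  ultimately have "(\<Sum>k\<in>N. \<integral>y. ?\<xi> k y \<partial>\<mu> k) \<le> (\<Sum>k\<in>N. \<integral>y. \<phi> k y \<partial>\<mu> k)"
    using dual_sol[unfolded dual_solution_def, THEN conjunct2, THEN conjunct2, THEN spec, of ?\<xi>] by simp
  moreover have "(\<Sum>k\<in>N. \<integral>y. ?\<xi> k y \<partial>\<mu> k) = (\<Sum>k\<in>N. (\<integral>y. \<phi> k y \<partial>\<mu> k) + (\<integral>y. \<psi> k y \<partial>\<mu> k))"
    using assms(1) \<phi>_integrable by (intro sum.cong) auto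
  ultimately show ?thesis by (simp add: sum.distrib)
qed

lemma cost_superlevel_open: "openin top_prod {x \<in> \<Omega>. t < c x}"
  using cost_lsc unfolding lsc_on_def topspace_top_prod by blast

text \<open>The inequality \<open>s + \<Sum> \<phi> k < c\<close> holds exactly if rationals
  \<open>q k > \<phi> k\<close> with \<open>s + \<Sum> q k < c\<close> can be inserted. For fixed
  \<open>q\<close> the condition on \<open>c\<close> is open, hence a countable union of boxes, and
  each condition on \<open>\<phi> k\<close> only cuts down one side of a box.\<close>

lemma slack_superlevel_boxes:
  "\<exists>\<V>. countable \<V> \<and> (\<forall>V\<in>\<V>. \<forall>k\<in>N. V k \<in> sets (\<mu> k)) \<and>
     {x\<in>\<Omega>. s < slack x} = (\<Union>V\<in>\<V>. PiE N V)"
proof -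
  have "\<exists>\<V>. countable \<V> \<and> (\<forall>V\<in>\<V>. \<forall>k\<in>N. V k \<in> sets (\<mu> k)) \<and> (\<Union>V\<in>\<V>. PiE N V) = {x \<in> \<Omega>. t < c x}" for t
    by (rule openin_top_prod_boxes[OF cost_superlevel_open[of t]]) blast
  then obtain \<V> where V: "\<And>t. countable (\<V> t)" "\<And>t V k. V \<in> \<V> t \<Longrightarrow> k \<in> N \<Longrightarrow> V k \<in> sets (\<mu> k)"
    "\<And>t. (\<Union>V\<in>\<V> t. PiE N V) = {x \<in> \<Omega>. t < c x}" by metis
  define W where "W q V k = V k \<inter> {y \<in> space (\<mu> k). \<phi> k y < q k}" for q :: "nat \<Rightarrow> real" and V k
  define \<W> where "\<W> = (\<Union>q\<in>PiE N (\<lambda>_. \<rat>). W q ` \<V> (s + (\<Sum>k\<in>N. q k)))"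
  have "countable (PiE N (\<lambda>_. \<rat> :: real set))" using finite_index countable_rat by (intro countable_PiE) auto
  then have "countable \<W>" unfolding \<W>_def using V(1) by auto
  moreover have "\<forall>V\<in>\<W>. \<forall>k\<in>N. V k \<in> sets (\<mu> k)"
  proof (intro ballI)
    fix V k assume "V \<in> \<W>" and k: "k \<in> N"
    then obtain q V' where "V' \<in> \<V> (s + (\<Sum>k\<in>N. q k))" "V = W q V'" by (auto simp: \<W>_def)
    moreover have "{y \<in> space (\<mu> k). \<phi> k y < q k} \<in> sets (\<mu> k)"
      using \<phi>_integrable[OF k] by (intro borel_measurable_less) auto
    ultimately show "V k \<in> sets (\<mu> k)" using V(2) k by (auto simp: W_def)
  qed
  moreover have "{x\<in>\<Omega>. s < slack x} = (\<Union>V\<in>\<W>. PiE N V)"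
  proof (intro set_eqI iffI)
    fix x assume "x \<in> {x\<in>\<Omega>. s < slack x}"
    then have x: "x \<in> \<Omega>" "s < slack x" by auto
    \<comment> \<open>The excess of the slack over \<open>s\<close> is shared equally: raising each
      \<open>\<phi> k\<close> by less than \<open>e\<close> keeps the inequality strict.\<close>
    define e where "e = (slack x - s) / card N"
    have card: "card N > 0" using index_ne finite_index by (auto simp: card_gt_0_iff)
    have "e > 0" using x(2) card by (simp add: e_def)
    have "\<exists>r\<in>\<rat>. \<phi> k (x k) < r \<and> r < \<phi> k (x k) + e" for k
      using Rats_dense_in_real[of "\<phi> k (x k)" "\<phi> k (x k) + e"] \<open>e > 0\<close> by auto
    then obtain r where r: "\<And>k. r k \<in> \<rat>" "\<And>k. \<phi> k (x k) < r k" "\<And>k. r k < \<phi> k (x k) + e" by metis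
    define q where "q = restrict r N"
    have q: "q \<in> PiE N (\<lambda>_. \<rat>)" using r by (auto simp: q_def)
    have "(\<Sum>k\<in>N. q k) < (\<Sum>k\<in>N. \<phi> k (x k) + e)"
      using r(3) index_ne finite_index by (intro sum_strict_mono) (auto simp: q_def)
    also have "\<dots> = (\<Sum>k\<in>N. \<phi> k (x k)) + (slack x - s)" using card by (simp add: sum.distrib e_def)
    finally have "s + (\<Sum>k\<in>N. q k) < c x" by (simp add: slack_def)
    then obtain V where V': "V \<in> \<V> (s + (\<Sum>k\<in>N. q k))" "x \<in> PiE N V"
      using V(3)[of "s + (\<Sum>k\<in>N. q k)"] x(1) by blast
    have "x k \<in> W q V k" if "k \<in> N" for k
      using V'(2) that r(2) x(1) by (auto simp: W_def q_def space_marginal \<Omega>_def)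
    then have "x \<in> PiE N (W q V)" using V'(2) by (simp add: PiE_iff)
    then show "x \<in> (\<Union>V\<in>\<W>. PiE N V)" using V'(1) q by (auto simp: \<W>_def)
  next
    fix x assume "x \<in> (\<Union>V\<in>\<W>. PiE N V)"
    then obtain q V where q: "V \<in> \<V> (s + (\<Sum>k\<in>N. q k))" and x: "x \<in> PiE N (W q V)"
      by (auto simp: \<W>_def)
    have "x \<in> PiE N V" using x by (auto simp: W_def PiE_iff)
    then have "x \<in> {x \<in> \<Omega>. s + (\<Sum>k\<in>N. q k) < c x}" using q unfolding V(3)[symmetric] by blast
    moreover have "(\<Sum>k\<in>N. \<phi> k (x k)) \<le> (\<Sum>k\<in>N. q k)"
      using x by (intro sum_mono) (auto simp: W_def PiE_iff intro: less_imp_le)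
    ultimately show "x \<in> {x\<in>\<Omega>. s < slack x}" by (simp add: slack_def)
  qed
  ultimately show ?thesis by blast
qed

lemma cost_measurable: "c \<in> borel_measurable (PiM N \<mu>)"
  unfolding borel_measurable_iff_greater space_product using openin_sets[OF cost_superlevel_open] by blast

text \<open>The sum of the \<open>\<phi> k\<close> has the same integral under every plan. A plan
  with vanishing slack has exactly this cost, so an optimal plan costs no more, while its cost
  function dominates that sum.\<close>

lemma optimal_plan_slack:
  assumes opt: "optimal_plan (plans \<mu> N) c lam"
  shows "AE x in lam. slack x = 0"
proof -
  let ?g = "\<lambda>x. \<Sum>k\<in>N. \<phi> k (x k)"
  obtain lam0 where lam0: "lam0 \<in> plans \<mu> N" "AE x in lam0. slack x = 0"
    using plan_with_vanishing_slack[OF index_ne slack_nonneg slack_superlevel_boxes slack_dual] by blast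
  have lam: "lam \<in> plans \<mu> N" using opt by (simp add: optimal_plan_def)
  have sets: "sets lam = sets (PiM N \<mu>)" using lam by (simp add: plans_def)
  have sp: "space lam = \<Omega>" using sets_eq_imp_space_eq[OF sets] space_product by simp
  have "ointegral lam0 c = ointegral lam0 ?g"
    by (rule ointegral_cong_AE) (use lam0(2) in \<open>auto simp: slack_def elim: AE_mp\<close>)
  also have "\<dots> = ereal (\<integral>x. ?g x \<partial>lam)"
    using plan_integral_separable[OF lam0(1) \<phi>_integrable] plan_integral_separable[OF lam \<phi>_integrable]
    by (simp add: ointegral_integrable)
  finally have "ointegral lam c \<le> ereal (\<integral>x. ?g x \<partial>lam)"
    using opt lam0(1) unfolding optimal_plan_def by metis
  moreover have "c \<in> borel_measurable lam" using cost_measurable sets by (simp cong: measurable_cong_sets)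
  moreover have "?g x \<le> c x" if "x \<in> space lam" for x
    using slack_nonneg[of x] that sp by (simp add: slack_def)
  ultimately have "AE x in lam. c x = ?g x"
    using plan_integral_separable(1)[OF lam \<phi>_integrable] by (intro AE_eq_if_ointegral_le)
  then show ?thesis by (simp add: slack_def)
qed

lemma \<Omega>_nonempty: "\<Omega> \<noteq> {}"
  unfolding \<Omega>_def using prob_space.not_empty[OF prob] space_marginal by (auto simp: PiE_eq_empty_iff)

text \<open>This rewrites the expression minimised in \<open>red_cost\<close>: the reduced cost at
  \<open>y\<close> is the sum of the \<open>\<phi> k\<close> over \<open>S\<close> plus the infimum
  of the slack over the fibre of \<open>y\<close>.\<close>

lemma cost_minus_complement:
  assumes S: "S \<subseteq> N" and x: "x \<in> \<Omega>" "restrict x S = y"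
  shows "(\<Sum>k\<in>S. \<phi> k (y k)) + slack x = c x - (\<Sum>k\<in>N - S. \<phi> k (x k))"
proof -
  have "(\<Sum>k\<in>N. \<phi> k (x k)) = (\<Sum>k\<in>N - S. \<phi> k (x k)) + (\<Sum>k\<in>S. \<phi> k (x k))"
    using S finite_index by (rule sum.subset_diff)
  moreover have "(\<Sum>k\<in>S. \<phi> k (x k)) = (\<Sum>k\<in>S. \<phi> k (y k))" using x(2) by (intro sum.cong) auto
  ultimately show ?thesis by (simp add: slack_def)
qed

lemma red_cost_ge:
  assumes S: "S \<subseteq> N" and y: "y \<in> PiE S (\<lambda>k. mspace (X k))"
  shows "(\<Sum>k\<in>S. \<phi> k (y k)) \<le> red_cost X N c \<phi> S y"
proof -
  \<comment> \<open>A point of \<open>\<Omega>\<close> fills in the missing coordinates; the fibre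
    must be nonempty for a real infimum to be bounded below by its lower bounds.\<close>
  obtain z where z: "z \<in> \<Omega>" using \<Omega>_nonempty by auto
  define x where "x k = (if k \<in> S then y k else z k)" for k
  have "x \<in> \<Omega>" "restrict x S = y"
    using y z S by (auto simp: \<Omega>_def x_def PiE_iff extensional_def fun_eq_iff)
  then have "{c x - (\<Sum>k\<in>N - S. \<phi> k (x k)) | x. x \<in> PiE N (\<lambda>k. mspace (X k)) \<and> restrict x S = y} \<noteq> {}"
    by (auto simp: \<Omega>_def)
  then show ?thesis unfolding red_cost_def
  proof (rule cInf_greatest)
    fix r assume "r \<in> {c x - (\<Sum>k\<in>N - S. \<phi> k (x k)) | x. x \<in> PiE N (\<lambda>k. mspace (X k)) \<and> restrict x S = y}"
    then obtain x where x: "x \<in> \<Omega>" "restrict x S = y" "r = c x - (\<Sum>k\<in>N - S. \<phi> k (x k))"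
      by (auto simp: \<Omega>_def)
    then show "(\<Sum>k\<in>S. \<phi> k (y k)) \<le> r" using cost_minus_complement[OF S x(1,2)] slack_nonneg[OF x(1)] by simp
  qed
qed

lemma red_cost_le:
  assumes S: "S \<subseteq> N" and x: "x \<in> \<Omega>" "slack x = 0"
  shows "red_cost X N c \<phi> S (restrict x S) \<le> (\<Sum>k\<in>S. \<phi> k (restrict x S k))"
  unfolding red_cost_def
proof (rule cInf_lower)
  let ?y = "restrict x S"
  let ?R = "{c x - (\<Sum>k\<in>N - S. \<phi> k (x k)) | x. x \<in> PiE N (\<lambda>k. mspace (X k)) \<and> restrict x S = ?y}"
  show "(\<Sum>k\<in>S. \<phi> k (restrict x S k)) \<in> ?R"
    using cost_minus_complement[OF S x(1) refl] x by (auto simp: \<Omega>_def intro!: exI[of _ x])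
  show "bdd_below ?R"
  proof (rule bdd_belowI)
    fix r assume "r \<in> ?R"
    then obtain z where z: "z \<in> \<Omega>" "restrict z S = ?y" "r = c z - (\<Sum>k\<in>N - S. \<phi> k (z k))"
      by (auto simp: \<Omega>_def)
    then show "(\<Sum>k\<in>S. \<phi> k (?y k)) \<le> r" using cost_minus_complement[OF S z(1,2)] slack_nonneg[OF z(1)] by simp
  qed
qed

text \<open>The lower bound from \<open>red_cost_ge\<close> has the same integral under every plan
  on \<open>S\<close>, so attaining it means optimality. Competitors are compared by monotonicity
  alone, without measurability of the reduced cost.\<close>

theorem projection_optimal:
  assumes opt: "optimal_plan (plans \<mu> N) c lam" and S: "S \<subseteq> N"
  shows "optimal_plan (plans \<mu> S) (red_cost X N c \<phi> S) (distr lam (PiM S \<mu>) (\<lambda>x. restrict x S))"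
proof -
  let ?g = "\<lambda>y. \<Sum>k\<in>S. \<phi> k (y k)" and ?\<tau> = "distr lam (PiM S \<mu>) (\<lambda>x. restrict x S)"
  interpret S: polish_product S X \<mu> using subproduct[OF S] .
  have \<phi>S: "integrable (\<mu> k) (\<phi> k)" if "k \<in> S" for k using \<phi>_integrable that S by auto
  have lam: "lam \<in> plans \<mu> N" using opt by (simp add: optimal_plan_def)
  have sets: "sets lam = sets (PiM N \<mu>)" using lam by (simp add: plans_def)
  have sp: "space lam = \<Omega>" using sets_eq_imp_space_eq[OF sets] space_product by simp
  note \<tau> = projection_in_plans[OF lam S]
  have ge: "?g y \<le> red_cost X N c \<phi> S y" if "y \<in> space (PiM S \<mu>)" for y
    using red_cost_ge[OF S, of y] that by (simp add: S.space_product S.\<Omega>_def)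
  have A: "{x \<in> space lam. slack x = 0} \<in> sets lam"
  proof -
    have "c \<in> borel_measurable lam" using cost_measurable sets by (simp cong: measurable_cong_sets)
    moreover have "(\<lambda>x. \<Sum>k\<in>N. \<phi> k (x k)) \<in> borel_measurable lam"
      using plan_integral_separable(1)[OF lam \<phi>_integrable] by auto
    ultimately show ?thesis unfolding slack_def by measurable
  qed
  have "AE y in ?\<tau>. y \<in> (\<lambda>x. restrict x S) ` {x \<in> space lam. slack x = 0}"
    using optimal_plan_slack[OF opt] by (intro AE_projection[OF index_ne lam S A]) (auto elim: AE_mp)
  then have "AE y in ?\<tau>. red_cost X N c \<phi> S y = ?g y"
  proof (rule AE_mp, intro AE_I2 impI)
    fix y assume y: "y \<in> space ?\<tau>" "y \<in> (\<lambda>x. restrict x S) ` {x \<in> space lam. slack x = 0}"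
    then obtain x where "x \<in> \<Omega>" "slack x = 0" "y = restrict x S" using sp by auto
    then show "red_cost X N c \<phi> S y = ?g y"
      using red_cost_le[OF S, of x] ge[of y] y(1) by simp
  qed
  then have eq: "ointegral ?\<tau> (red_cost X N c \<phi> S) = ereal (\<Sum>k\<in>S. \<integral>y. \<phi> k y \<partial>\<mu> k)"
    using plan_integral_separable[OF \<tau> \<phi>S] by (simp add: ointegral_cong_AE ointegral_integrable)
  have "ointegral ?\<tau> (red_cost X N c \<phi> S) \<le> ointegral \<sigma> (red_cost X N c \<phi> S)" if \<sigma>: "\<sigma> \<in> plans \<mu> S" for \<sigma>
  proof -
    have "space \<sigma> = space (PiM S \<mu>)" by (rule sets_eq_imp_space_eq) (use \<sigma> in \<open>simp add: plans_def\<close>)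
    then have "ereal (\<integral>y. ?g y \<partial>\<sigma>) \<le> ointegral \<sigma> (red_cost X N c \<phi> S)"
      using ge plan_integral_separable(1)[OF \<sigma> \<phi>S] by (intro ointegral_ge) auto
    then show ?thesis using eq plan_integral_separable(2)[OF \<sigma> \<phi>S] by simp
  qed
  then show ?thesis using \<tau> by (simp add: optimal_plan_def)
qed

end

section \<open>Reconstruction of a plan from its projections\<close>

context polish_product
begin

text \<open>A countable base separates points, so \<open>f z\<close> and \<open>g z\<close> differ
  exactly if some base set contains the first and not the second.\<close>

lemma equaliser_sets:
  assumes k: "k \<in> N" and f: "f \<in> M \<rightarrow>\<^sub>M \<mu> k" and g: "g \<in> M \<rightarrow>\<^sub>M \<mu> k"
  shows "{z \<in> space M. f z = g z} \<in> sets M"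
proof -
  let ?T = "mtopology_of (X k)"
  obtain \<B> where B: "countable \<B>" "\<And>V. V \<in> \<B> \<Longrightarrow> openin ?T V"
    "\<And>U x. openin ?T U \<Longrightarrow> x \<in> U \<Longrightarrow> \<exists>V\<in>\<B>. x \<in> V \<and> V \<subseteq> U"
    using second_countable_mtopology_of[OF separable[OF k]] unfolding second_countable_def by metis
  have sep: "\<exists>V\<in>\<B>. x \<in> V \<and> y \<notin> V" if xy: "x \<in> space (\<mu> k)" "y \<in> space (\<mu> k)" "x \<noteq> y" for x y
  proof -
    have "x \<in> topspace ?T" "y \<in> topspace ?T" using xy space_marginal[OF k] by auto
    then obtain U W where UW: "openin ?T U" "openin ?T W" "x \<in> U" "y \<in> W" "disjnt U W"
      using Hausdorff_space_mtopology_of[of "X k"] xy(3) unfolding Hausdorff_space_def by metis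
    then obtain V where "V \<in> \<B>" "x \<in> V" "V \<subseteq> U" using B(3) by blast
    then show ?thesis using UW by (auto simp: disjnt_def)
  qed
  have "{z \<in> space M. f z = g z} =
      space M - (\<Union>V\<in>\<B>. (f -` V \<inter> space M) - (g -` V \<inter> space M))"
  proof (intro set_eqI iffI)
    fix z assume z: "z \<in> space M - (\<Union>V\<in>\<B>. (f -` V \<inter> space M) - (g -` V \<inter> space M))"
    have "f z \<in> space (\<mu> k)" "g z \<in> space (\<mu> k)" using z f g by (auto dest: measurable_space)
    then show "z \<in> {z \<in> space M. f z = g z}" using sep[of "f z" "g z"] z by auto
  qed auto
  also have "\<dots> \<in> sets M"
    using B(1) measurable_sets[OF f openin_marginal_sets[OF k B(2)]]
      measurable_sets[OF g openin_marginal_sets[OF k B(2)]]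
    by (intro sets.Diff sets.top sets.countable_UN') auto
  finally show ?thesis .
qed

text \<open>The equations hold at every point \<open>merge P S (p, T p)\<close>. They define a
  measurable set by \<open>equaliser_sets\<close>, so they pass to the image measure, which is
  \<open>\<tau>\<close> itself.\<close>

lemma graph_plan_AE:
  assumes S: "S \<subseteq> N" and disj: "S \<inter> P = {}" and T: "T \<in> PiM P \<mu> \<rightarrow>\<^sub>M PiM S \<mu>"
    and sets: "sets \<tau> = sets (PiM (S \<union> P) \<mu>)"
    and graph: "\<tau> = distr (distr \<tau> (PiM P \<mu>) (\<lambda>x. restrict x P)) (PiM (S \<union> P) \<mu>)
                       (\<lambda>p. merge P S (p, T p))"
  shows "AE y in \<tau>. \<forall>k\<in>S. y k = T (restrict y P) k"
proof -
  have finS: "finite S" using S finite_index by (rule finite_subset)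
  have res: "(\<lambda>x. restrict x P) \<in> PiM (S \<union> P) \<mu> \<rightarrow>\<^sub>M PiM P \<mu>" by (intro measurable_restrict_subset) auto
  have comp: "{y \<in> space (PiM (S \<union> P) \<mu>). y k = T (restrict y P) k} \<in> sets (PiM (S \<union> P) \<mu>)" if k: "k \<in> S" for k
  proof (rule equaliser_sets)
    show "k \<in> N" using k S by auto
    show "(\<lambda>y. y k) \<in> PiM (S \<union> P) \<mu> \<rightarrow>\<^sub>M \<mu> k" using k by (intro measurable_component_singleton) auto
    show "(\<lambda>y. T (restrict y P) k) \<in> PiM (S \<union> P) \<mu> \<rightarrow>\<^sub>M \<mu> k"
      using measurable_compose[OF measurable_compose[OF res T] measurable_component_singleton[OF k]] .
  qed
  have H: "{y \<in> space (PiM (S \<union> P) \<mu>). \<forall>k\<in>S. y k = T (restrict y P) k} \<in> sets (PiM (S \<union> P) \<mu>)"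
    using comp finS by (intro sets.sets_Collect_finite_All) auto
  have m: "(\<lambda>p. merge P S (p, T p)) \<in> PiM P \<mu> \<rightarrow>\<^sub>M PiM (S \<union> P) \<mu>"
    using measurable_compose[OF measurable_Pair[OF measurable_ident T] measurable_merge[of P S \<mu>]]
    by (simp add: Un_commute id_def)
  have AE: "AE y in distr (distr \<tau> (PiM P \<mu>) (\<lambda>x. restrict x P)) (PiM (S \<union> P) \<mu>) (\<lambda>p. merge P S (p, T p)).
      \<forall>k\<in>S. y k = T (restrict y P) k"
  proof (subst AE_distr_iff)
    show "AE p in distr \<tau> (PiM P \<mu>) (\<lambda>x. restrict x P).
        \<forall>k\<in>S. merge P S (p, T p) k = T (restrict (merge P S (p, T p)) P) k"
    proof (rule AE_I2, rule ballI)
      fix p k assume p: "p \<in> space (distr \<tau> (PiM P \<mu>) (\<lambda>x. restrict x P))" and k: "k \<in> S"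
      have "restrict (merge P S (p, T p)) P = p"
        using p by (auto simp: space_PiM PiE_iff extensional_def merge_def fun_eq_iff)
      moreover have "k \<notin> P" using k disj by auto
      ultimately show "merge P S (p, T p) k = T (restrict (merge P S (p, T p)) P) k"
        using k by (simp add: merge_def)
    qed
  qed (use m H in simp_all)
  show ?thesis by (subst graph) (rule AE)
qed

end

section \<open>Assembling the blocks of coordinates\<close>

locale partitioned_product = polish_product N X \<mu>
  for N and X :: "nat \<Rightarrow> 'a metric" and \<mu> +
  fixes P Q R :: "nat set" and J :: "'j set" and Qs :: "'j \<Rightarrow> nat set"
  assumes P_sub: "P \<subseteq> N" and Q_sub: "Q \<subseteq> N - P" and R_eq: "R = Q \<union> P"
    and disj: "\<And>i j. i \<in> J \<Longrightarrow> j \<in> J \<Longrightarrow> i \<noteq> j \<Longrightarrow> Qs i \<inter> Qs j = {}"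
    and cover: "(\<Union>j\<in>J. Qs j) = N - R"
begin

lemma assemble_P: "k \<in> P \<Longrightarrow> assemble P Q J Qs T p q k = p k"
  by (simp add: assemble_def)

lemma assemble_Q: "k \<in> Q \<Longrightarrow> assemble P Q J Qs T p q k = q k"
  using Q_sub by (auto simp: assemble_def)

lemma assemble_Qs:
  assumes "j \<in> J" "k \<in> Qs j"
  shows "assemble P Q J Qs T p q k = T j p k"
proof -
  have "k \<notin> P" "k \<notin> Q" using assms cover R_eq by auto
  moreover have "(SOME j. j \<in> J \<and> k \<in> Qs j) = j"
    using assms disj by (intro some_equality) auto
  ultimately show ?thesis using assms by (auto simp: assemble_def)
qed

lemma assemble_outside: "k \<notin> N \<Longrightarrow> assemble P Q J Qs T p q k = undefined"
  using P_sub Q_sub cover by (auto simp: assemble_def)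

lemma index_cases:
  assumes "k \<in> N"
  obtains "k \<in> P" | "k \<in> Q" | j where "j \<in> J" "k \<in> Qs j"
  using assms cover R_eq by blast

lemma Qs_sub: "j \<in> J \<Longrightarrow> Qs j \<subseteq> N - R"
  using cover by blast

lemma measurable_assemble:
  assumes T: "\<And>j. j \<in> J \<Longrightarrow> T j \<in> PiM P \<mu> \<rightarrow>\<^sub>M PiM (Qs j) \<mu>"
  shows "(\<lambda>y. assemble P Q J Qs T (restrict y P) (restrict y Q)) \<in> PiM R \<mu> \<rightarrow>\<^sub>M PiM N \<mu>"
proof -
  have "(\<lambda>y. assemble P Q J Qs T (restrict y P) (restrict y Q) k) \<in> PiM R \<mu> \<rightarrow>\<^sub>M \<mu> k" if "k \<in> N" for k
    using that
  proof (cases rule: index_cases)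
    case 1
    then show ?thesis using R_eq by (simp add: assemble_P)
  next
    case 2
    then show ?thesis using R_eq by (simp add: assemble_Q)
  next
    case (3 j)
    have "(\<lambda>x. restrict x P) \<in> PiM R \<mu> \<rightarrow>\<^sub>M PiM P \<mu>" using R_eq by (intro measurable_restrict_subset) auto
    from measurable_compose[OF measurable_compose[OF this T[OF 3(1)]] measurable_component_singleton[OF 3(2)]]
    show ?thesis by (simp add: assemble_Qs[OF 3])
  qed
  then have "(\<lambda>y. \<lambda>k\<in>N. assemble P Q J Qs T (restrict y P) (restrict y Q) k) \<in> PiM R \<mu> \<rightarrow>\<^sub>M PiM N \<mu>"
    by (rule measurable_restrict)
  moreover have "(\<lambda>y. \<lambda>k\<in>N. assemble P Q J Qs T (restrict y P) (restrict y Q) k) =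
      (\<lambda>y. assemble P Q J Qs T (restrict y P) (restrict y Q))"
    by (auto simp: fun_eq_iff assemble_outside)
  ultimately show ?thesis by simp
qed

text \<open>Almost every \<open>x\<close> is recovered from its restriction to \<open>R\<close> by
  assembling, so the image of \<open>lam\<close> under this operation is \<open>lam\<close>. The
  right-hand side depends on \<open>lam\<close> only through its projection to \<open>R\<close>,
  which is what makes uniqueness possible.\<close>

lemma plan_eq_distr_assemble:
  assumes lam: "lam \<in> plans \<mu> N"
    and T: "\<And>j. j \<in> J \<Longrightarrow> T j \<in> PiM P \<mu> \<rightarrow>\<^sub>M PiM (Qs j) \<mu>"
    and graph: "\<And>j \<tau>. j \<in> J \<Longrightarrow> \<tau> = distr lam (PiM (Qs j \<union> P) \<mu>) (\<lambda>x. restrict x (Qs j \<union> P)) \<Longrightarrow>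
      \<tau> = distr (distr \<tau> (PiM P \<mu>) (\<lambda>x. restrict x P)) (PiM (Qs j \<union> P) \<mu>) (\<lambda>p. merge P (Qs j) (p, T j p))"
  shows "lam = distr (distr lam (PiM R \<mu>) (\<lambda>x. restrict x R)) (PiM N \<mu>)
      (\<lambda>y. assemble P Q J Qs T (restrict y P) (restrict y Q))"
proof -
  let ?A = "\<lambda>y. assemble P Q J Qs T (restrict y P) (restrict y Q)"
  have sets: "sets lam = sets (PiM N \<mu>)" using lam by (simp add: plans_def)
  have sp: "space lam = \<Omega>" using sets_eq_imp_space_eq[OF sets] space_product by simp
  have R_sub: "R \<subseteq> N" using P_sub Q_sub R_eq by auto
  have AE_j: "AE x in lam. \<forall>k\<in>Qs j. x k = T j (restrict x P) k" if j: "j \<in> J" for j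
  proof -
    let ?S = "Qs j \<union> P"
    have S: "Qs j \<subseteq> N" "Qs j \<inter> P = {}" using Qs_sub[OF j] R_eq by auto
    have m: "(\<lambda>x. restrict x ?S) \<in> lam \<rightarrow>\<^sub>M PiM ?S \<mu>"
      using S P_sub by (intro measurable_restrict_plan[OF sets]) auto
    have "AE y in distr lam (PiM ?S \<mu>) (\<lambda>x. restrict x ?S). \<forall>k\<in>Qs j. y k = T j (restrict y P) k"
      using graph[OF j refl] by (intro graph_plan_AE[OF S T[OF j]]) auto
    then have "AE x in lam. \<forall>k\<in>Qs j. restrict x ?S k = T j (restrict (restrict x ?S) P) k"
      by (rule AE_distrD[OF m])
    moreover have "restrict (restrict x ?S) P = restrict x P" for x
      by (auto simp: restrict_def fun_eq_iff)
    ultimately show ?thesis by (auto elim: AE_mp)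
  qed
  \<comment> \<open>Nonempty disjoint subsets of the finite set \<open>N\<close> are finite in
    number, so the almost sure statements for the single \<open>j\<close> can be combined.\<close>
  let ?J = "{j \<in> J. Qs j \<noteq> {}}"
  have fin: "finite ?J"
  proof (rule inj_on_finite[of Qs])
    show "inj_on Qs ?J" using disj by (auto simp: inj_on_def)
    show "Qs ` ?J \<subseteq> Pow N" using Qs_sub by blast
    show "finite (Pow N)" using finite_index by simp
  qed
  have "AE x in lam. \<forall>j\<in>?J. \<forall>k\<in>Qs j. x k = T j (restrict x P) k"
    by (rule AE_finite_allI[OF fin]) (simp add: AE_j)
  then have "AE x in lam. ?A (restrict x R) = x"
  proof (rule AE_mp, intro AE_I2 impI)
    fix x assume x: "x \<in> space lam" and eq: "\<forall>j\<in>?J. \<forall>k\<in>Qs j. x k = T j (restrict x P) k"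
    have res: "restrict (restrict x R) P = restrict x P" by (auto simp: R_eq restrict_def fun_eq_iff)
    show "?A (restrict x R) = x"
    proof
      fix k
      show "?A (restrict x R) k = x k"
      proof (cases "k \<in> N")
        case True
        then show ?thesis
        proof (cases rule: index_cases)
          case (3 j)
          then have "x k = T j (restrict x P) k" using eq by blast
          then show ?thesis unfolding assemble_Qs[OF 3] res by simp
        qed (auto simp: assemble_P assemble_Q R_eq)
      next
        case False
        then have "x k = undefined" using x unfolding sp \<Omega>_def by (rule PiE_arb[rotated])
        then show ?thesis by (simp add: assemble_outside[OF False])
      qed
    qed
  qed
  moreover note mA = measurable_assemble[of T, OF T] and mR = measurable_restrict_plan[OF sets R_sub]
  ultimately have "distr lam (PiM N \<mu>) (\<lambda>x. ?A (restrict x R)) = distr lam (PiM N \<mu>) (\<lambda>x. x)"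
    using sets measurable_compose[OF mR mA] by (intro distr_cong_AE) (auto simp: measurable_ident_sets)
  also have "\<dots> = distr lam lam (\<lambda>x. x)" using sets by (intro distr_cong) auto
  also have "\<dots> = lam" by (rule distr_id)
  finally show ?thesis using distr_distr[OF mA mR] by (simp add: comp_def)
qed

text \<open>Images commute with \<open>bind\<close>, and restricting \<open>merge P Q (p, q)\<close>
  to \<open>P\<close> and \<open>Q\<close> returns \<open>p\<close> and \<open>q\<close>.\<close>

lemma distr_assemble_disintegration:
  assumes lam: "lam \<in> plans \<mu> N"
    and T: "\<And>j. j \<in> J \<Longrightarrow> T j \<in> PiM P \<mu> \<rightarrow>\<^sub>M PiM (Qs j) \<mu>"
    and \<kappa>: "\<kappa> \<in> PiM P \<mu> \<rightarrow>\<^sub>M prob_algebra (PiM Q \<mu>)"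
  shows "distr (bind (distr lam (PiM P \<mu>) (\<lambda>x. restrict x P))
        (\<lambda>p. distr (\<kappa> p) (PiM R \<mu>) (\<lambda>q. merge P Q (p, q)))) (PiM N \<mu>)
      (\<lambda>y. assemble P Q J Qs T (restrict y P) (restrict y Q)) =
    bind (distr lam (PiM P \<mu>) (\<lambda>x. restrict x P))
      (\<lambda>p. distr (\<kappa> p) (PiM N \<mu>) (\<lambda>q. assemble P Q J Qs T p q))"
proof -
  let ?L = "distr lam (PiM P \<mu>) (\<lambda>x. restrict x P)"
  let ?A = "\<lambda>y. assemble P Q J Qs T (restrict y P) (restrict y Q)"
  note mA = measurable_assemble[of T, OF T]
  have PQ: "P \<union> Q = R" "P \<inter> Q = {}" using R_eq Q_sub by auto
  have mrg: "merge P Q \<in> PiM P \<mu> \<Otimes>\<^sub>M PiM Q \<mu> \<rightarrow>\<^sub>M PiM R \<mu>"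
    using measurable_merge[of P Q \<mu>] PQ(1) by simp
  have \<kappa>': "\<kappa> \<in> PiM P \<mu> \<rightarrow>\<^sub>M subprob_algebra (PiM Q \<mu>)" using \<kappa> by (rule measurable_prob_algebraD)
  have K: "(\<lambda>p. distr (\<kappa> p) (PiM R \<mu>) (\<lambda>q. merge P Q (p, q))) \<in> ?L \<rightarrow>\<^sub>M subprob_algebra (PiM R \<mu>)"
    using measurable_distr2[OF _ \<kappa>', of "\<lambda>p q. merge P Q (p, q)"] mrg by simp
  interpret L: prob_space ?L using projection_in_plans[OF lam P_sub] by (simp add: plans_def)
  have "distr (bind ?L (\<lambda>p. distr (\<kappa> p) (PiM R \<mu>) (\<lambda>q. merge P Q (p, q)))) (PiM N \<mu>) ?A =
      bind ?L (\<lambda>p. distr (distr (\<kappa> p) (PiM R \<mu>) (\<lambda>q. merge P Q (p, q))) (PiM N \<mu>) ?A)"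
    using K L.not_empty mA by (rule distr_bind)
  also have "\<dots> = bind ?L (\<lambda>p. distr (\<kappa> p) (PiM N \<mu>) (\<lambda>q. assemble P Q J Qs T p q))"
  proof (rule bind_cong[OF refl])
    fix p assume "p \<in> space ?L"
    then have p: "p \<in> space (PiM P \<mu>)" by simp
    have sk: "sets (\<kappa> p) = sets (PiM Q \<mu>)" using \<kappa>' p by (rule sets_kernel)
    have m: "(\<lambda>q. merge P Q (p, q)) \<in> \<kappa> p \<rightarrow>\<^sub>M PiM R \<mu>"
      using measurable_compose[OF measurable_Pair1'[OF p] mrg] sk by (simp cong: measurable_cong_sets)
    have "distr (distr (\<kappa> p) (PiM R \<mu>) (\<lambda>q. merge P Q (p, q))) (PiM N \<mu>) ?A =
        distr (\<kappa> p) (PiM N \<mu>) (?A \<circ> (\<lambda>q. merge P Q (p, q)))"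
      using mA m by (rule distr_distr)
    also have "\<dots> = distr (\<kappa> p) (PiM N \<mu>) (\<lambda>q. assemble P Q J Qs T p q)"
    proof (rule distr_cong)
      fix q assume "q \<in> space (\<kappa> p)"
      then have q: "q \<in> space (PiM Q \<mu>)" using sets_eq_imp_space_eq[OF sk] by simp
      have "restrict (merge P Q (p, q)) P = p" "restrict (merge P Q (p, q)) Q = q"
        using p q PQ(2) by (auto simp: space_PiM PiE_iff extensional_def merge_def fun_eq_iff)
      then show "(?A \<circ> (\<lambda>q. merge P Q (p, q))) q = assemble P Q J Qs T p q" by simp
    qed auto
    finally show "distr (distr (\<kappa> p) (PiM R \<mu>) (\<lambda>q. merge P Q (p, q))) (PiM N \<mu>) ?A =
        distr (\<kappa> p) (PiM N \<mu>) (\<lambda>q. assemble P Q J Qs T p q)" .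
  qed
  finally show ?thesis .
qed

end

text \<open>The product of the Dirac masses at the points \<open>T j p\<close> with
  \<open>\<kappa> p\<close> is expressed as the image of \<open>\<kappa> p\<close> under
  \<open>assemble P Q J Qs T p\<close>. The kernel \<open>\<kappa>\<close> ranges over all versions
  of the disintegration.\<close>

theorem mainTheorem5:
  fixes n :: nat and N :: "nat set"
    and X :: "nat \<Rightarrow> 'a metric" and \<mu> :: "nat \<Rightarrow> 'a measure"
    and c :: "(nat \<Rightarrow> 'a) \<Rightarrow> real" and a :: "nat \<Rightarrow> 'a \<Rightarrow> real"
    and \<phi> :: "nat \<Rightarrow> 'a \<Rightarrow> real"
    and P Q R :: "nat set" and J :: "'j set" and Qs :: "'j \<Rightarrow> nat set"
  assumes n3: "n \<ge> 3" and N_def: "N = {1..n}"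
    and complete: "\<And>k. k \<in> N \<Longrightarrow> mcomplete_of (X k)"
    and separable: "\<And>k. k \<in> N \<Longrightarrow> separable_space (mtopology_of (X k))"
    and prob: "\<And>k. k \<in> N \<Longrightarrow> prob_space (\<mu> k)"
    and borel: "\<And>k. k \<in> N \<Longrightarrow> sets (\<mu> k) = sets (borel_of (mtopology_of (X k)))"
    and lsc: "lsc_on (product_topology (\<lambda>k. mtopology_of (X k)) N) c"
    and a_int: "\<And>k. k \<in> N \<Longrightarrow> integrable (\<mu> k) (a k)"
    and c_lb: "\<And>x. x \<in> PiE N (\<lambda>k. mspace (X k)) \<Longrightarrow> (\<Sum>k\<in>N. a k (x k)) \<le> c x"
    and attained: "\<exists>lam. optimal_plan (plans \<mu> N) c lam"
    and dual: "dual_solution X \<mu> N c \<phi>"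
    and P: "P \<subset> N"
    and Q: "Q \<noteq> {}" "Q \<subset> N - P"
    and R_def: "R = Q \<union> P"
    and Qs_ne: "\<And>j. j \<in> J \<Longrightarrow> Qs j \<noteq> {}"
    and Qs_disj: "\<And>i j. i \<in> J \<Longrightarrow> j \<in> J \<Longrightarrow> i \<noteq> j \<Longrightarrow> Qs i \<inter> Qs j = {}"
    and Qs_cover: "(\<Union>j\<in>J. Qs j) = N - R"
    and graph: "\<And>j \<tau>. j \<in> J \<Longrightarrow>
        optimal_plan (plans \<mu> (Qs j \<union> P)) (red_cost X N c \<phi> (Qs j \<union> P)) \<tau> \<Longrightarrow>
        \<exists>T \<in> PiM P \<mu> \<rightarrow>\<^sub>M PiM (Qs j) \<mu>.
          \<tau> = distr (distr \<tau> (PiM P \<mu>) (\<lambda>x. restrict x P)) (PiM (Qs j \<union> P) \<mu>)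
                 (\<lambda>p. merge P (Qs j) (p, T p))"
  shows "(\<forall>lam \<kappa>. optimal_plan (plans \<mu> N) c lam
            \<and> \<kappa> \<in> PiM P \<mu> \<rightarrow>\<^sub>M prob_algebra (PiM Q \<mu>)
            \<and> distr lam (PiM R \<mu>) (\<lambda>x. restrict x R) =
                bind (distr lam (PiM P \<mu>) (\<lambda>x. restrict x P))
                  (\<lambda>p. distr (\<kappa> p) (PiM R \<mu>) (\<lambda>q. merge P Q (p, q)))
          \<longrightarrow> (\<exists>T. (\<forall>j\<in>J. T j \<in> PiM P \<mu> \<rightarrow>\<^sub>M PiM (Qs j) \<mu>) \<and>
                 lam = bind (distr lam (PiM P \<mu>) (\<lambda>x. restrict x P))
                       (\<lambda>p. distr (\<kappa> p) (PiM N \<mu>) (\<lambda>q. assemble P Q J Qs T p q))))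
       \<and> ((\<exists>!\<tau>. optimal_plan (plans \<mu> R) (red_cost X N c \<phi> R) \<tau>) \<and>
          (\<forall>j\<in>J. \<exists>!\<tau>. optimal_plan (plans \<mu> (Qs j \<union> P)) (red_cost X N c \<phi> (Qs j \<union> P)) \<tau>)
          \<longrightarrow> (\<exists>!lam. optimal_plan (plans \<mu> N) c lam))"
proof -
  have base: "polish_product N X \<mu>"
    using complete separable prob borel by (auto simp: polish_product_def N_def)
  interpret transport_dual N X \<mu> c \<phi>
    using n3 lsc dual
    by (intro transport_dual.intro base) (auto simp: transport_dual_axioms_def N_def)
  interpret partitioned_product N X \<mu> P Q R J Qs
    using P Q R_def Qs_disj Qs_cover
    by (intro partitioned_product.intro base) (auto simp: partitioned_product_axioms_def)
  let ?proj = "\<lambda>lam S. distr lam (PiM S \<mu>) (\<lambda>x. restrict x S)"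
  have R_sub: "R \<subseteq> N" and Rj_sub: "\<And>j. j \<in> J \<Longrightarrow> Qs j \<union> P \<subseteq> N"
    using P_sub Q_sub R_eq Qs_sub by auto
  have maps: "\<exists>T. (\<forall>j\<in>J. T j \<in> PiM P \<mu> \<rightarrow>\<^sub>M PiM (Qs j) \<mu>) \<and>
      (\<forall>j\<in>J. ?proj lam (Qs j \<union> P) = distr (?proj (?proj lam (Qs j \<union> P)) P) (PiM (Qs j \<union> P) \<mu>)
        (\<lambda>p. merge P (Qs j) (p, T j p)))" if opt: "optimal_plan (plans \<mu> N) c lam" for lam
  proof -
    have "\<forall>j\<in>J. \<exists>T. T \<in> PiM P \<mu> \<rightarrow>\<^sub>M PiM (Qs j) \<mu> \<and>
      ?proj lam (Qs j \<union> P) = distr (?proj (?proj lam (Qs j \<union> P)) P) (PiM (Qs j \<union> P) \<mu>)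
        (\<lambda>p. merge P (Qs j) (p, T p))"
      using graph[OF _ projection_optimal[OF opt Rj_sub]] by blast
    then show ?thesis by (rule bchoice[THEN exE]) blast
  qed
  have plan: "lam \<in> plans \<mu> N" if "optimal_plan (plans \<mu> N) c lam" for lam
    using that by (simp add: optimal_plan_def)
  show ?thesis
  proof (intro conjI allI impI)
    fix lam \<kappa>
    assume "optimal_plan (plans \<mu> N) c lam
            \<and> \<kappa> \<in> PiM P \<mu> \<rightarrow>\<^sub>M prob_algebra (PiM Q \<mu>)
            \<and> distr lam (PiM R \<mu>) (\<lambda>x. restrict x R) =
                bind (distr lam (PiM P \<mu>) (\<lambda>x. restrict x P))
                  (\<lambda>p. distr (\<kappa> p) (PiM R \<mu>) (\<lambda>q. merge P Q (p, q)))"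
    then have opt: "optimal_plan (plans \<mu> N) c lam" and \<kappa>: "\<kappa> \<in> PiM P \<mu> \<rightarrow>\<^sub>M prob_algebra (PiM Q \<mu>)"
      and dis: "?proj lam R = bind (?proj lam P) (\<lambda>p. distr (\<kappa> p) (PiM R \<mu>) (\<lambda>q. merge P Q (p, q)))"
      by auto
    obtain T where T_all: "\<forall>j\<in>J. T j \<in> PiM P \<mu> \<rightarrow>\<^sub>M PiM (Qs j) \<mu>"
      and gr_all: "\<forall>j\<in>J. ?proj lam (Qs j \<union> P) =
        distr (?proj (?proj lam (Qs j \<union> P)) P) (PiM (Qs j \<union> P) \<mu>) (\<lambda>p. merge P (Qs j) (p, T j p))"
      using maps[OF opt] by (elim exE conjE) (rule that)
    note T = bspec[OF T_all] and gr = bspec[OF gr_all]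
    have "lam = distr (?proj lam R) (PiM N \<mu>)
      (\<lambda>y. assemble P Q J Qs T (restrict y P) (restrict y Q))"
      using gr by (intro plan_eq_distr_assemble[OF plan[OF opt] T]) simp_all
    also have "\<dots> = bind (?proj lam P) (\<lambda>p. distr (\<kappa> p) (PiM N \<mu>) (\<lambda>q. assemble P Q J Qs T p q))"
      unfolding dis by (rule distr_assemble_disintegration[OF plan[OF opt] T \<kappa>])
    finally show "\<exists>T. (\<forall>j\<in>J. T j \<in> PiM P \<mu> \<rightarrow>\<^sub>M PiM (Qs j) \<mu>) \<and>
                 lam = bind (distr lam (PiM P \<mu>) (\<lambda>x. restrict x P))
                       (\<lambda>p. distr (\<kappa> p) (PiM N \<mu>) (\<lambda>q. assemble P Q J Qs T p q))"
      using T by blast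
  next
    assume uniq: "(\<exists>!\<tau>. optimal_plan (plans \<mu> R) (red_cost X N c \<phi> R) \<tau>) \<and>
          (\<forall>j\<in>J. \<exists>!\<tau>. optimal_plan (plans \<mu> (Qs j \<union> P)) (red_cost X N c \<phi> (Qs j \<union> P)) \<tau>)"
    have "lam = lam'" if opt: "optimal_plan (plans \<mu> N) c lam" "optimal_plan (plans \<mu> N) c lam'" for lam lam'
    proof -
      have eqR: "?proj lam R = ?proj lam' R"
        using uniq projection_optimal[OF opt(1) R_sub] projection_optimal[OF opt(2) R_sub] by blast
      have eqj: "?proj lam (Qs j \<union> P) = ?proj lam' (Qs j \<union> P)" if "j \<in> J" for j
        using uniq that projection_optimal[OF opt(1) Rj_sub[OF that]]
          projection_optimal[OF opt(2) Rj_sub[OF that]] by blast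
      obtain T where T_all: "\<forall>j\<in>J. T j \<in> PiM P \<mu> \<rightarrow>\<^sub>M PiM (Qs j) \<mu>"
        and gr_all: "\<forall>j\<in>J. ?proj lam (Qs j \<union> P) =
          distr (?proj (?proj lam (Qs j \<union> P)) P) (PiM (Qs j \<union> P) \<mu>) (\<lambda>p. merge P (Qs j) (p, T j p))"
        using maps[OF opt(1)] by (elim exE conjE) (rule that)
      note T = bspec[OF T_all] and gr = bspec[OF gr_all]
      have "lam = distr (?proj lam R) (PiM N \<mu>)
        (\<lambda>y. assemble P Q J Qs T (restrict y P) (restrict y Q))"
        using gr by (intro plan_eq_distr_assemble[OF plan[OF opt(1)] T]) simp_all
      also have "\<dots> = distr (?proj lam' R) (PiM N \<mu>)
        (\<lambda>y. assemble P Q J Qs T (restrict y P) (restrict y Q))"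
        by (simp only: eqR)
      \<comment> \<open>The maps were chosen for \<open>lam\<close>, but their graph equations speak
        only of projections to the sets \<open>Qs j \<union> P\<close>, which \<open>lam'\<close>
        shares; hence the same maps rebuild \<open>lam'\<close>.\<close>
      also have "\<dots> = lam'"
        using gr eqj by (intro plan_eq_distr_assemble[OF plan[OF opt(2)] T, symmetric]) simp_all
      finally show ?thesis .
    qed
    then show "\<exists>!lam. optimal_plan (plans \<mu> N) c lam" using attained by blast
  qed
qed

end
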